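(* Let $\mathbf{A}\in\mathbb{H}^{m\times n}$ and $\mathbf{W}\in\mathbb{H}^{n\times m}$ be such that $\mathbf{W}\mathbf{A}=\mathbf{U}\in\mathbb{H}^{n\times n}$ is Hermitian, let $k=\max\{\mathrm{Ind}(\mathbf{A}\mathbf{W}),\mathrm{Ind}(\mathbf{W}\mathbf{A})\}$ and $\operatorname{rank}(\mathbf{W}\mathbf{A})^{k+1}=\operatorname{rank}(\mathbf{W}\mathbf{A})^{k}=r$. Then the W-weighted Drazin inverse $\mathbf{A}_{d,\mathbf{W}}=(a_{ij}^{d,\mathbf{W}})\in\mathbb{H}^{m\times n}$ of $\mathbf{A}$ with respect to $\mathbf{W}$ possesses the determinantal representation $$a_{ij}^{d,\mathbf{W}}=\frac{\displaystyle\sum_{\alpha\in I_{r,n}\{j\}}\mathrm{rdet}_{j}\left(\left((\mathbf{W}\mathbf{A})^{k+2}\right)_{j.}\left(\bar{\mathbf{u}}_{i.}^{(k)}\right)\right)_{\alpha}^{\alpha}}{\displaystyle\sum_{\alpha\in I_{r,n}}\left|\left((\mathbf{W}\mathbf{A})^{k+2}\right)_{\alpha}^{\alpha}\right|}$$ for all $i=1,\dots,m$ and $j=1,\dots,n$, where $\bar{\mathbf{u}}_{i.}^{(k)}$ is the $i$th row of $\bar{\mathbf{U}}^{k}:=\mathbf{A}(\mathbf{W}\mathbf{A})^{k}\in\mathbb{H}^{m\times n}$ for $i=1,\dots,m$.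
   Context: $\mathbb{H}$ is the skew field of real quaternions, $\mathbb{H}^{m\times n}$ the $m\times n$ matrices over $\mathbb{H}$, $\mathbf{M}^{*}$ the conjugate transpose; $\mathbf{M}$ is Hermitian if $\mathbf{M}^{*}=\mathbf{M}$. Rank is the dimension of the right column space. For square $\mathbf{M}$, $\mathrm{Ind}(\mathbf{M})$ is the smallest nonnegative integer $k$ with $\operatorname{rank}\mathbf{M}^{k+1}=\operatorname{rank}\mathbf{M}^{k}$. W-weighted Drazin inverse: with $k=\max\{\mathrm{Ind}(\mathbf{A}\mathbf{W}),\mathrm{Ind}(\mathbf{W}\mathbf{A})\}$, $\mathbf{A}_{d,\mathbf{W}}$ is the unique $\mathbf{X}\in\mathbb{H}^{m\times n}$ with $(\mathbf{A}\mathbf{W})^{k+1}\mathbf{X}\mathbf{W}=(\mathbf{A}\mathbf{W})^{k}$, $\mathbf{X}\mathbf{W}\mathbf{A}\mathbf{W}\mathbf{X}=\mathbf{X}$, $\mathbf{A}\mathbf{W}\mathbf{X}=\mathbf{X}\mathbf{W}\mathbf{A}$. Row determinant: for $\mathbf{M}=(m_{pq})\in\mathbb{H}^{n\times n}$ and $1\le i\le n$, $$\mathrm{rdet}_{i}\mathbf{M}=\sum_{\sigma\in S_{n}}(-1)^{n-\rho}\,m_{i\,i_{k_1}}m_{i_{k_1}i_{k_1+1}}\cdots m_{i_{k_1+l_1}\,i}\cdots m_{i_{k_\rho}i_{k_\rho+1}}\cdots m_{i_{k_\rho+l_\rho}i_{k_\rho}},$$ where $\sigma=(i\,i_{k_1}i_{k_1+1}\dots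 i_{k_1+l_1})(i_{k_2}i_{k_2+1}\dots i_{k_2+l_2})\cdots(i_{k_\rho}i_{k_\rho+1}\dots i_{k_\rho+l_\rho})$ is written as a product of its $\rho$ disjoint cycles (fixed points included), the first cycle starts with $i$, each other cycle starts with its smallest element, and $i_{k_2}<i_{k_3}<\dots<i_{k_\rho}$. Column determinant: for $1\le j\le n$, $$\mathrm{cdet}_{j}\mathbf{M}=\sum_{\tau\in S_{n}}(-1)^{n-\rho}\,m_{j_{k_\rho}j_{k_\rho+l_\rho}}\cdots m_{j_{k_\rho+1}j_{k_\rho}}\cdots m_{j\,j_{k_1+l_1}}\cdots m_{j_{k_1+1}j_{k_1}}m_{j_{k_1}j},$$ where $\tau=(j_{k_\rho+l_\rho}\dots j_{k_\rho+1}j_{k_\rho})\cdots(j_{k_2+l_2}\dots j_{k_2+1}j_{k_2})(j_{k_1+l_1}\dots j_{k_1+1}j_{k_1}j)$, with $\rho$ the number of disjoint cycles (fixed points included), the last cycle ends with $j$, each other cycle ends with its smallest element, and $j_{k_2}<\dots<j_{k_\rho}$. For Hermitian $\mathbf{M}$ all $\mathrm{rdet}_i\mathbf{M}$ and $\mathrm{cdet}_j\mathbf{M}$ coincide and are real; this common value is $\det\mathbf{M}$. Notation: $\mathbf{M}_{j.}(\mathbf{b})$ is $\mathbf{M}$ with its $j$th row replaced by the row $\mathbf{b}$. $\mathbf{M}_{\alpha}^{\alpha}$ is the principal submatrix with rows and columns indexed by $\alpha$; $|\mathbf{M}_{\alpha}^{\alpha}|$ is its determinant when $\mathbf{M}$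 is Hermitian. For $j\in\alpha$, $\mathrm{rdet}_j$ of a principal submatrix indexed by $\alpha$ is taken along the row with original index $j$. $I_{r,n}$ is the set of strictly increasing sequences (equivalently subsets) $\alpha$ of $r$ elements of $\{1,\dots,n\}$, and $I_{r,n}\{j\}=\{\alpha\in I_{r,n}: j\in\alpha\}$; these are defined for $1\le r\le n$, so $r\ge1$ is implicit. *)

theory Defs
  imports Complex_Main "HOL-Combinatorics.Combinatorics" "Jordan_Normal_Form.Matrix"
begin

section \<open>Real quaternions\<close>

datatype quat = Quat (qre: real) (qim1: real) (qim2: real) (qim3: real)

lemma quat_eqI:
  "qre x = qre y \<Longrightarrow> qim1 x = qim1 y \<Longrightarrow> qim2 x = qim2 y \<Longrightarrow> qim3 x = qim3 y \<Longrightarrow> x = y"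
  by (rule quat.expand) simp

lemma quat_eq_iff:
  "x = y \<longleftrightarrow> qre x = qre y \<and> qim1 x = qim1 y \<and> qim2 x = qim2 y \<and> qim3 x = qim3 y"
  by (auto intro: quat_eqI)

definition qcnj :: "quat \<Rightarrow> quat" where
  "qcnj x = Quat (qre x) (- qim1 x) (- qim2 x) (- qim3 x)"

definition qnorm2 :: "quat \<Rightarrow> real" where
  "qnorm2 x = (qre x)\<^sup>2 + (qim1 x)\<^sup>2 + (qim2 x)\<^sup>2 + (qim3 x)\<^sup>2"

instantiation quat :: real_div_algebra
begin

definition zero_quat :: quat where "0 = Quat 0 0 0 0"
definition one_quat :: quat where "1 = Quat 1 0 0 0"
definition plus_quat :: "quat \<Rightarrow> quat \<Rightarrow> quat" where
  "x + y = Quat (qre x + qre y) (qim1 x + qim1 y) (qim2 x + qim2 y) (qim3 x + qim3 y)"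
definition uminus_quat :: "quat \<Rightarrow> quat" where
  "- x = Quat (- qre x) (- qim1 x) (- qim2 x) (- qim3 x)"
definition minus_quat :: "quat \<Rightarrow> quat \<Rightarrow> quat" where
  "x - y = Quat (qre x - qre y) (qim1 x - qim1 y) (qim2 x - qim2 y) (qim3 x - qim3 y)"
definition scaleR_quat :: "real \<Rightarrow> quat \<Rightarrow> quat" where
  "scaleR c x = Quat (c * qre x) (c * qim1 x) (c * qim2 x) (c * qim3 x)"
definition times_quat :: "quat \<Rightarrow> quat \<Rightarrow> quat" where
  "x * y = Quat
     (qre x * qre y - qim1 x * qim1 y - qim2 x * qim2 y - qim3 x * qim3 y)
     (qre x * qim1 y + qim1 x * qre y + qim2 x * qim3 y - qim3 x * qim2 y)
     (qre x * qim2 y - qim1 x * qim3 y + qim2 x * qre y + qim3 x * qim1 y)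
     (qre x * qim3 y + qim1 x * qim2 y - qim2 x * qim1 y + qim3 x * qre y)"
definition inverse_quat :: "quat \<Rightarrow> quat" where
  "inverse x = scaleR (1 / qnorm2 x) (qcnj x)"
definition divide_quat :: "quat \<Rightarrow> quat \<Rightarrow> quat" where
  "x div y = x * inverse (y :: quat)"

lemma qnorm2_pos:
  assumes "(x :: quat) \<noteq> 0" shows "qnorm2 x > 0"
proof (rule ccontr)
  assume "\<not> qnorm2 x > 0"
  moreover have "(qre x)\<^sup>2 \<ge> 0" "(qim1 x)\<^sup>2 \<ge> 0" "(qim2 x)\<^sup>2 \<ge> 0" "(qim3 x)\<^sup>2 \<ge> 0" by simp_all
  ultimately have "(qre x)\<^sup>2 = 0" "(qim1 x)\<^sup>2 = 0" "(qim2 x)\<^sup>2 = 0" "(qim3 x)\<^sup>2 = 0"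
    unfolding qnorm2_def by linarith+
  then show False using assms by (simp add: quat_eq_iff zero_quat_def)
qed

lemma qcnj_times_self:
  "qcnj x * x = Quat (qnorm2 x) 0 0 0" "x * qcnj x = Quat (qnorm2 x) 0 0 0"
  by (simp_all add: quat_eq_iff times_quat_def qcnj_def qnorm2_def power2_eq_square)

instance
proof
  fix x y z :: quat and a b :: real
  show "x + y + z = x + (y + z)" "x + y = y + x" "0 + x = x" "- x + x = 0" "x - y = x + - y"
    by (simp_all add: quat_eq_iff plus_quat_def zero_quat_def uminus_quat_def minus_quat_def)
  show "a *\<^sub>R (x + y) = a *\<^sub>R x + a *\<^sub>R y" "(a + b) *\<^sub>R x = a *\<^sub>R x + b *\<^sub>R x"
    "a *\<^sub>R b *\<^sub>R x = (a * b) *\<^sub>R x" "1 *\<^sub>R x = x"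
    by (simp_all add: quat_eq_iff plus_quat_def scaleR_quat_def algebra_simps)
  show "x * y * z = x * (y * z)" "1 * x = x" "x * 1 = x"
    "(x + y) * z = x * z + y * z" "x * (y + z) = x * y + x * z"
    by (simp_all add: quat_eq_iff plus_quat_def times_quat_def one_quat_def algebra_simps)
  show "(0 :: quat) \<noteq> 1" by (simp add: zero_quat_def one_quat_def)
  show sl: "a *\<^sub>R x * y = a *\<^sub>R (x * y)" for a and x y :: quat
    by (simp add: quat_eq_iff times_quat_def scaleR_quat_def algebra_simps)
  show sr: "x * a *\<^sub>R y = a *\<^sub>R (x * y)" for a and x y :: quat
    by (simp add: quat_eq_iff times_quat_def scaleR_quat_def algebra_simps)
  show "inverse x * x = 1" "x * inverse x = 1" if "x \<noteq> 0"
    using qnorm2_pos[OF that]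
    by (simp_all add: inverse_quat_def sl sr qcnj_times_self)
       (simp_all add: quat_eq_iff scaleR_quat_def one_quat_def)
  show "x div y = x * inverse y" by (rule divide_quat_def)
  show "inverse (0 :: quat) = 0"
    by (simp add: inverse_quat_def quat_eq_iff scaleR_quat_def qcnj_def qnorm2_def zero_quat_def)
qed

end

section \<open>Quaternion matrices\<close>

text \<open>Matrices and their products are those of Jordan_Normal_Form, whose entries range over an
  arbitrary semiring, so the entrywise products keep their order. Indices start at 0.\<close>

definition conj_transpose :: "quat mat \<Rightarrow> quat mat" where
  "conj_transpose M = mat (dim_col M) (dim_row M) (\<lambda>(p, q). qcnj (M $$ (q, p)))"

definition q_hermitian :: "quat mat \<Rightarrow> bool" where
  "q_hermitian M \<longleftrightarrow> conj_transpose M = M"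

definition replace_row :: "quat mat \<Rightarrow> nat \<Rightarrow> quat vec \<Rightarrow> quat mat" where
  "replace_row M j b =
     mat (dim_row M) (dim_col M) (\<lambda>(p, q). if p = j then b $ q else M $$ (p, q))"

text \<open>The library's notions of span, independence and dimension need a commutative ring of
  scalars, so they are restated here for vectors with scalars acting on the right.\<close>

definition right_lincomb :: "nat \<Rightarrow> (quat vec \<Rightarrow> quat) \<Rightarrow> quat vec set \<Rightarrow> quat vec" where
  "right_lincomb m c B = vec m (\<lambda>p. \<Sum>v\<in>B. v $ p * c v)"

definition right_span :: "nat \<Rightarrow> quat vec set \<Rightarrow> quat vec set" where
  "right_span m B = {right_lincomb m c B' | c B'. finite B' \<and> B' \<subseteq> B}"

definition right_indep :: "nat \<Rightarrow> quat vec set \<Rightarrow> bool" where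
  "right_indep m B \<longleftrightarrow>
     (\<forall>c B'. finite B' \<longrightarrow> B' \<subseteq> B \<longrightarrow> right_lincomb m c B' = 0\<^sub>v m \<longrightarrow> (\<forall>v\<in>B'. c v = 0))"

definition right_basis :: "nat \<Rightarrow> quat vec set \<Rightarrow> quat vec set \<Rightarrow> bool" where
  "right_basis m V B \<longleftrightarrow> B \<subseteq> V \<and> right_indep m B \<and> right_span m B = V"

definition right_dim :: "nat \<Rightarrow> quat vec set \<Rightarrow> nat" where
  "right_dim m V = card (SOME B. right_basis m V B)"

definition q_rank :: "quat mat \<Rightarrow> nat" where
  "q_rank M = right_dim (dim_row M) (right_span (dim_row M) (set (cols M)))"

definition mat_index :: "quat mat \<Rightarrow> nat" where
  "mat_index M = (LEAST k. q_rank (M ^\<^sub>m (k + 1)) = q_rank (M ^\<^sub>m k))"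

section \<open>The W-weighted Drazin inverse\<close>

definition is_weighted_drazin :: "quat mat \<Rightarrow> quat mat \<Rightarrow> quat mat \<Rightarrow> bool" where
  "is_weighted_drazin A W X \<longleftrightarrow>
     (let k = max (mat_index (A * W)) (mat_index (W * A)) in
        X \<in> carrier_mat (dim_row A) (dim_col A)
      \<and> (A * W) ^\<^sub>m (k + 1) * X * W = (A * W) ^\<^sub>m k
      \<and> X * W * A * W * X = X
      \<and> A * W * X = X * W * A)"

definition weighted_drazin :: "quat mat \<Rightarrow> quat mat \<Rightarrow> quat mat" where
  "weighted_drazin A W = (THE X. is_weighted_drazin A W X)"

section \<open>Row and column determinants\<close>

text \<open>Determinants are taken over a finite set \<open>S\<close> of row and column indices, so that
  \<open>rdet S i M\<close> is the \<open>i\<close>th row determinant of the principal submatrix of \<open>M\<close> indexed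
  by \<open>S\<close>, with \<open>i\<close> being the index in \<open>M\<close>. For an \<open>n\<close> by \<open>n\<close> matrix, the row determinant
  is \<open>rdet {..<n} i M\<close>.\<close>

text \<open>The first element of each cycle of \<open>\<sigma>\<close>: \<open>i\<close> for the cycle through \<open>i\<close>, which comes
  first, then the smallest elements of all other cycles in increasing order.\<close>

definition cycle_starts :: "nat set \<Rightarrow> nat \<Rightarrow> (nat \<Rightarrow> nat) \<Rightarrow> nat list" where
  "cycle_starts S i \<sigma> =
     i # sorted_list_of_set {Min (orbit \<sigma> s) | s. s \<in> S \<and> i \<notin> orbit \<sigma> s}"

text \<open>For the cycle \<open>(s s\<^sub>1 \<dots> s\<^sub>l)\<close> of \<open>\<sigma>\<close>, where \<open>s \<mapsto> s\<^sub>1 \<mapsto> \<dots> \<mapsto> s\<^sub>l \<mapsto> s\<close>, this is the ordered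
  product of the entries at \<open>(s, s\<^sub>1), (s\<^sub>1, s\<^sub>2), \<dots>, (s\<^sub>l, s)\<close>; the list \<open>support \<sigma> s\<close> is
  \<open>[s, s\<^sub>1, \<dots>, s\<^sub>l]\<close>.\<close>

definition cycle_prod :: "quat mat \<Rightarrow> (nat \<Rightarrow> nat) \<Rightarrow> nat \<Rightarrow> quat" where
  "cycle_prod M \<sigma> s = prod_list (map (\<lambda>p. M $$ (p, \<sigma> p)) (support \<sigma> s))"

definition rdet :: "nat set \<Rightarrow> nat \<Rightarrow> quat mat \<Rightarrow> quat" where
  "rdet S i M =
     (\<Sum>\<sigma> | \<sigma> permutes S.
        (- 1) ^ (card S - length (cycle_starts S i \<sigma>)) *
        prod_list (map (cycle_prod M \<sigma>) (cycle_starts S i \<sigma>)))"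

text \<open>In the column determinant a cycle is written \<open>(j\<^sub>l \<dots> j\<^sub>1 j)\<close>, ending with its distinguished
  element \<open>j\<close>, so \<open>j \<mapsto> j\<^sub>l\<close> and \<open>j\<^sub>1 \<mapsto> j\<close>. Its factor is the product of the entries at
  \<open>(j, j\<^sub>l), \<dots>, (j\<^sub>2, j\<^sub>1), (j\<^sub>1, j)\<close>, which is again \<open>cycle_prod\<close> started at \<open>j\<close>. Only the order of
  the cycles is reversed.\<close>

definition cdet :: "nat set \<Rightarrow> nat \<Rightarrow> quat mat \<Rightarrow> quat" where
  "cdet S j M =
     (\<Sum>\<tau> | \<tau> permutes S.
        (- 1) ^ (card S - length (cycle_starts S j \<tau>)) *
        prod_list (map (cycle_prod M \<tau>) (rev (cycle_starts S j \<tau>))))"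

text \<open>The common real value of all row and column determinants of a Hermitian principal submatrix
  with nonempty index set \<open>S\<close>.\<close>

definition hdet :: "nat set \<Rightarrow> quat mat \<Rightarrow> real" where
  "hdet S M = (THE d. \<forall>i\<in>S. rdet S i M = of_real d \<and> cdet S i M = of_real d)"

definition index_sets :: "nat \<Rightarrow> nat \<Rightarrow> nat set set" where
  "index_sets r n = {\<alpha>. \<alpha> \<subseteq> {..<n} \<and> card \<alpha> = r}"

definition index_sets_at :: "nat \<Rightarrow> nat \<Rightarrow> nat \<Rightarrow> nat set set" where
  "index_sets_at r n j = {\<alpha> \<in> index_sets r n. j \<in> \<alpha>}"

end

theory Submission
  imports Defs
begin

text \<open>Write \<open>U = W A\<close> and \<open>M = U\<^sup>k\<^sup>+\<^sup>2\<close>, a Hermitian matrix. In the commutative case the formula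
is Cramer's rule read off from \<open>z (t I + M) = b\<close>: the numerator and the denominator are coefficients of
the adjugate and of the determinant of \<open>t I + M\<close>. The same works over the quaternions once two facts
about row determinants of Hermitian matrices are known: they are real and do not depend on the row
(\<open>hermitian_minors\<close>), and they vanish when one row is overwritten by another one
(\<open>rdet_replace_by_other_row\<close>). Both follow from splitting off the cycle through the distinguished row.
Permutations of \<open>S\<close> correspond to pairs of a list \<open>i # v\<close> of distinct elements and a permutation of what
is left (\<open>rdet_expand\<close>); reversing the list \<open>v\<close> conjugates the cycle product, whence reality, and cutting
a list at an element \<open>j\<close> exchanges the cases ``\<open>j\<close> lies on this cycle'' and ``\<open>j\<close> lies on another
cycle'', whence the cancellation.

Let \<open>d\<^sub>s\<close> be the sum of the principal minors of size \<open>s\<close> and \<open>G\<^sub>s\<close> the matrix whose \<open>(l, j)\<close> entry is the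
sum of the row determinants of the principal submatrices of size \<open>s\<close> with row \<open>j\<close> replaced by the unit
vector \<open>e\<^sub>l\<close>. The numerator of the claim is an entry of \<open>A U\<^sup>k G\<^sub>r\<close>, and the two facts give the
Faddeev--LeVerrier recursion \<open>G\<^sub>s\<^sub>+\<^sub>1 = d\<^sub>s I - M G\<^sub>s\<close> together with \<open>Re tr G\<^sub>s\<^sub>+\<^sub>1 = (n - s) d\<^sub>s\<close>
(\<open>adjugate_recursion\<close>, \<open>retrace_adjugate\<close>). If \<open>q\<close> is the last index with \<open>d\<^sub>q \<noteq> 0\<close>, the recursion above
\<open>q\<close> reads \<open>G\<^sub>s\<^sub>+\<^sub>1 = - M G\<^sub>s\<close> and ends in \<open>0\<close>; since \<open>M\<close> is Hermitian this forces \<open>M G\<^sub>q\<^sub>+\<^sub>1 = 0\<close>. Hence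
\<open>T = G\<^sub>q / d\<^sub>q\<close> satisfies \<open>M M T = M\<close>, and the projection \<open>M T\<close> has real trace \<open>q\<close>
(\<open>hermitian_group_inverse\<close>). As the real trace of a projection is its rank, \<open>q = r\<close>, which also shows that
the denominator \<open>d\<^sub>r\<close> does not vanish.

It remains to see that \<open>A U\<^sup>k T\<close> satisfies the equations of the weighted Drazin inverse and that these have
only one solution (\<open>weighted_drazin_eq\<close>, \<open>weighted_drazin_unique\<close>). For the first equation it must be known
that \<open>(A W)\<^sup>k\<close> is a right multiple of \<open>(A W)\<^sup>k\<^sup>+\<^sup>1\<close>, which is what equality of ranks means
(\<open>q_rank_eq_imp_right_factor\<close>). The facts on dimension over the quaternions that this needs are derived from
the same recursion, applied to Gram matrices (\<open>cancellable_left_inverse\<close>).\<close>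

section \<open>Splitting off one cycle of a permutation\<close>

definition arrangements :: "'a set \<Rightarrow> 'a list set" where
  "arrangements T = {v. distinct v \<and> set v \<subseteq> T}"

definition cycle_mins :: "nat set \<Rightarrow> (nat \<Rightarrow> nat) \<Rightarrow> nat set" where
  "cycle_mins S \<tau> = (\<lambda>s. Min (orbit \<tau> s)) ` S"

text \<open>The ordered product of the entries at consecutive positions of \<open>xs\<close>, followed by the entry
leading from the last position to \<open>y\<close>. Keeping the end point separate covers both closed cycles, as
\<open>walk M (i # v) i\<close>, and the pieces into which a cycle is cut.\<close>

fun walk :: "quat mat \<Rightarrow> nat list \<Rightarrow> nat \<Rightarrow> quat" where
  "walk M [] y = 1"
| "walk M (x # xs) y = M $$ (x, hd (xs @ [y])) * walk M xs y"

text \<open>The determinant in which every cycle, the first one included, starts at its smallest element. It is what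
remains of a row determinant after its first cycle has been split off, and it is \<open>1\<close> on the empty set,
where there is no row to expand along.\<close>

definition row_minor :: "quat mat \<Rightarrow> nat set \<Rightarrow> quat" where
  "row_minor M S = (\<Sum>\<tau> | \<tau> permutes S. (- 1) ^ (card S - card (cycle_mins S \<tau>)) *
     prod_list (map (cycle_prod M \<tau>) (sorted_list_of_set (cycle_mins S \<tau>))))"

definition column_minor :: "quat mat \<Rightarrow> nat set \<Rightarrow> quat" where
  "column_minor M S = (\<Sum>\<tau> | \<tau> permutes S. (- 1) ^ (card S - card (cycle_mins S \<tau>)) *
     prod_list (map (cycle_prod M \<tau>) (rev (sorted_list_of_set (cycle_mins S \<tau>)))))"

lemma finite_arrangements [simp]: "finite T \<Longrightarrow> finite (arrangements T)"
  unfolding arrangements_def using finite_subset_distinct[of T] by (simp add: conj_commute)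

lemma permutes_finite_imp_permutation: "p permutes S \<Longrightarrow> finite S \<Longrightarrow> permutation p"
  by (auto simp: permutation_permutes)

lemma funpow_cong:
  assumes "x \<in> A" "\<And>y. y \<in> A \<Longrightarrow> f y = g y" "\<And>y. y \<in> A \<Longrightarrow> g y \<in> A"
  shows "(f ^^ n) x = (g ^^ n) x"
proof -
  have "(f ^^ n) x = (g ^^ n) x \<and> (g ^^ n) x \<in> A"
    by (induction n) (use assms in auto)
  then show ?thesis ..
qed

lemma support_cong:
  assumes "x \<in> A" "\<And>y. y \<in> A \<Longrightarrow> f y = g y" "\<And>y. y \<in> A \<Longrightarrow> g y \<in> A"
  shows "support f x = support g x" "orbit f x = orbit g x"
  using funpow_cong[OF assms] by (auto simp: least_power_def orbit_altdef)

text \<open>Powers of the cycle rotate the list, so the orbit of its head lists the elements in order.\<close>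

lemma support_cycle_of_list:
  assumes "distinct xs" "xs \<noteq> []"
  shows "support (cycle_of_list xs) (hd xs) = xs" "orbit (cycle_of_list xs) (hd xs) = set xs"
proof -
  let ?c = "cycle_of_list xs"
  have pow: "(?c ^^ n) (hd xs) = xs ! (n mod length xs)" for n
  proof -
    have "(?c ^^ n) (hd xs) = hd (map (?c ^^ n) xs)" using assms by (simp add: hd_map)
    also have "\<dots> = hd (rotate n xs)" using cyclic_rotation[OF assms(1), of n] by simp
    also have "\<dots> = xs ! (n mod length xs)" using assms by (simp add: hd_rotate_conv_nth)
    finally show ?thesis .
  qed
  have lp: "least_power ?c (hd xs) = length xs"
    unfolding least_power_def
  proof (rule Least_equality)
    show "(?c ^^ length xs) (hd xs) = hd xs \<and> length xs > 0"
      using pow[of "length xs"] assms by (simp add: hd_conv_nth)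
    fix y assume y: "(?c ^^ y) (hd xs) = hd xs \<and> y > 0"
    show "length xs \<le> y"
    proof (rule ccontr)
      assume "\<not> length xs \<le> y"
      then have "xs ! y = xs ! 0" "y < length xs" using y pow[of y] assms by (auto simp: hd_conv_nth)
      then show False using assms y by (auto simp: nth_eq_iff_index_eq)
    qed
  qed
  have "map (\<lambda>n. xs ! (n mod length xs)) [0..<length xs] = map (\<lambda>n. xs ! n) [0..<length xs]"
    by (rule map_cong) auto
  then show sup: "support ?c (hd xs) = xs"
    unfolding lp pow by (simp add: map_nth)
  have p: "permutation ?c" by (rule permutation_of_cycle)
  show "orbit ?c (hd xs) = set xs"
    using support_set[OF p, of "hd xs"] unfolding sup
    by (auto simp: orbit_altdef_permutation[OF p])
qed

lemma prod_list_walk: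
  "map \<sigma> xs = tl xs @ [y] \<Longrightarrow> prod_list (map (\<lambda>p. M $$ (p, \<sigma> p)) xs) = walk M xs y"
proof (induction xs)
  case (Cons x xs)
  then show ?case by (cases xs) auto
qed simp

text \<open>The permutation composed of the cycle \<open>i # v\<close> and a permutation \<open>\<tau>\<close> of the remaining elements. Every
ingredient of a summand of the row determinant splits accordingly: the list of cycle starts, the product
of the entries and the exponent of the sign.\<close>

locale glued_permutation =
  fixes S :: "nat set" and i :: nat and v :: "nat list" and \<tau> :: "nat \<Rightarrow> nat"
  assumes finS: "finite S" and iS: "i \<in> S"
    and v: "v \<in> arrangements (S - {i})"
    and \<tau>: "\<tau> permutes (S - {i} - set v)"
begin

definition "\<sigma> = cycle_of_list (i # v) \<circ> \<tau>"

lemma distinct_cycle: "distinct (i # v)" and cycle_subset: "set (i # v) \<subseteq> S"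
  using v iS by (auto simp: arrangements_def)

lemma on_cycle: "y \<in> set (i # v) \<Longrightarrow> \<sigma> y = cycle_of_list (i # v) y"
  using \<tau> by (simp add: \<sigma>_def permutes_def del: cycle_of_list.simps)

lemma off_cycle: "y \<notin> set (i # v) \<Longrightarrow> \<sigma> y = \<tau> y"
proof -
  assume y: "y \<notin> set (i # v)"
  have "\<tau> y \<notin> set (i # v)"
  proof (cases "y \<in> S")
    case True
    then have "\<tau> y \<in> S - {i} - set v" using y permutes_in_image[OF \<tau>, of y] by simp
    then show ?thesis by simp
  next
    case False
    then have "\<tau> y = y" using \<tau> by (auto simp: permutes_def)
    then show ?thesis using y by simp
  qed
  then show ?thesis by (simp add: \<sigma>_def id_outside_supp del: cycle_of_list.simps)
qed

lemma permutes: "\<sigma> permutes S"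
  unfolding \<sigma>_def
  by (rule permutes_compose[OF permutes_subset[OF \<tau>]
        permutes_subset[OF cycle_permutes cycle_subset]]) auto

lemma support_i: "support \<sigma> i = i # v" and orbit_i: "orbit \<sigma> i = set (i # v)"
proof -
  have "cycle_of_list (i # v) y \<in> set (i # v)" if "y \<in> set (i # v)" for y
    using that by (simp only: permutes_in_image[OF cycle_permutes])
  then have "support \<sigma> i = support (cycle_of_list (i # v)) i"
    "orbit \<sigma> i = orbit (cycle_of_list (i # v)) i"
    using on_cycle support_cong[of i "set (i # v)" \<sigma> "cycle_of_list (i # v)"] by auto
  then show "support \<sigma> i = i # v" "orbit \<sigma> i = set (i # v)"
    using support_cycle_of_list[OF distinct_cycle] by simp_all
qed

lemma rest: "s \<in> S - {i} - set v \<Longrightarrow> support \<sigma> s = support \<tau> s"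
  "s \<in> S - {i} - set v \<Longrightarrow> orbit \<sigma> s = orbit \<tau> s"
proof -
  assume s: "s \<in> S - {i} - set v"
  have "\<tau> y \<in> S - {i} - set v" if "y \<in> S - {i} - set v" for y
    using that permutes_in_image[OF \<tau>] by blast
  moreover have "\<sigma> y = \<tau> y" if "y \<in> S - {i} - set v" for y
    using that off_cycle by auto
  ultimately show "support \<sigma> s = support \<tau> s" "orbit \<sigma> s = orbit \<tau> s"
    using support_cong[of s "S - {i} - set v" \<sigma> \<tau>] s by auto
qed

lemma cycle_mins_subset: "cycle_mins (S - {i} - set v) \<tau> \<subseteq> S - {i} - set v"
proof -
  have perm: "permutation \<tau>" using \<tau> finS by (auto intro: permutes_finite_imp_permutation)
  have "Min (orbit \<tau> s) \<in> orbit \<tau> s" for s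
    using finite_orbit[OF permutation_self_in_orbit[OF perm, of s]] orbit_nonempty[of \<tau> s]
    by (rule Min_in)
  then show ?thesis using permutes_orbit_subset[OF \<tau>] by (fastforce simp: cycle_mins_def)
qed

lemma starts: "cycle_starts S i \<sigma> = i # sorted_list_of_set (cycle_mins (S - {i} - set v) \<tau>)"
proof -
  have perm: "permutation \<sigma>" using permutes finS by (rule permutes_finite_imp_permutation)
  have "i \<notin> orbit \<sigma> s \<longleftrightarrow> s \<notin> set (i # v)" for s
    using orbit_i orbit_swap[OF permutation_self_in_orbit[OF perm]] by metis
  then have "{Min (orbit \<sigma> s) | s. s \<in> S \<and> i \<notin> orbit \<sigma> s} =
      (\<lambda>s. Min (orbit \<sigma> s)) ` (S - {i} - set v)" by auto
  also have "\<dots> = cycle_mins (S - {i} - set v) \<tau>"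
    unfolding cycle_mins_def using rest(2) by (intro image_cong) auto
  finally show ?thesis by (simp add: cycle_starts_def)
qed

lemma prod_i: "cycle_prod M \<sigma> i = walk M (i # v) i"
proof -
  have "map \<sigma> (i # v) = map (cycle_of_list (i # v)) (i # v)"
    using on_cycle by (intro map_cong) auto
  also have "\<dots> = v @ [i]"
    using cyclic_rotation[OF distinct_cycle, of 1] by (simp del: cycle_of_list.simps)
  finally show ?thesis unfolding cycle_prod_def support_i by (intro prod_list_walk) simp
qed

lemma prod_rest:
  assumes "s \<in> cycle_mins (S - {i} - set v) \<tau>"
  shows "cycle_prod M \<sigma> s = cycle_prod M \<tau> s"
proof -
  have s: "s \<in> S - {i} - set v" using assms cycle_mins_subset by blast
  have "permutation \<tau>" using \<tau> finS by (auto intro: permutes_finite_imp_permutation)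
  then have "set (support \<tau> s) = orbit \<tau> s"
    using support_set[of \<tau> s] orbit_altdef_permutation[of \<tau> s] by auto
  then have sub: "set (support \<tau> s) \<subseteq> S - {i} - set v"
    using permutes_orbit_subset[OF \<tau> s] by simp
  have "\<sigma> p = \<tau> p" if "p \<in> set (support \<tau> s)" for p
    using subsetD[OF sub that] off_cycle[of p] by auto
  then have "map (\<lambda>p. M $$ (p, \<sigma> p)) (support \<tau> s) = map (\<lambda>p. M $$ (p, \<tau> p)) (support \<tau> s)"
    by (intro map_cong) auto
  then show ?thesis unfolding cycle_prod_def rest(1)[OF s] by (rule arg_cong)
qed

lemma sign: "card S - length (cycle_starts S i \<sigma>) =
   length v + (card (S - {i} - set v) - card (cycle_mins (S - {i} - set v) \<tau>))"
proof -
  have 1: "card S = Suc (length v + card (S - {i} - set v))"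
  proof -
    have "card S = card (set (i # v)) + card (S - set (i # v))"
      using cycle_subset finS by (metis card_Diff_subset card_mono finite_set le_add_diff_inverse)
    moreover have "S - set (i # v) = S - {i} - set v" by auto
    ultimately show ?thesis using distinct_card[OF distinct_cycle] by simp
  qed
  have "card (cycle_mins (S - {i} - set v) \<tau>) \<le> card (S - {i} - set v)"
    using finS cycle_mins_subset by (intro card_mono) auto
  then show ?thesis using 1 by (simp add: starts)
qed

end

text \<open>The inverse map sends \<open>\<sigma>\<close> to the list of the cycle through \<open>i\<close> and to the restriction of \<open>\<sigma>\<close> outside
this cycle.\<close>

lemma bij_betw_glued_permutations:
  fixes S :: "nat set"
  assumes "finite S" "i \<in> S"
  shows "bij_betw (\<lambda>(v, \<tau>). cycle_of_list (i # v) \<circ> \<tau>)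
    (SIGMA v:arrangements (S - {i}). {\<tau>. \<tau> permutes (S - {i} - set v)}) {\<sigma>. \<sigma> permutes S}"
proof (rule bij_betwI')
  let ?g = "\<lambda>(v, \<tau>). cycle_of_list (i # v) \<circ> \<tau>"
  fix x y assume x: "x \<in> (SIGMA v:arrangements (S - {i}). {\<tau>. \<tau> permutes (S - {i} - set v)})"
    and y: "y \<in> (SIGMA v:arrangements (S - {i}). {\<tau>. \<tau> permutes (S - {i} - set v)})"
  obtain v \<tau> v' \<tau>' where xy: "x = (v, \<tau>)" "y = (v', \<tau>')" by (cases x, cases y) auto
  interpret x: glued_permutation S i v \<tau> using x assms by unfold_locales (auto simp: xy)
  interpret y: glued_permutation S i v' \<tau>' using y assms by unfold_locales (auto simp: xy)
  show "?g x = ?g y \<longleftrightarrow> x = y"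
  proof
    assume "?g x = ?g y"
    then have eq: "x.\<sigma> = y.\<sigma>" by (simp add: xy x.\<sigma>_def y.\<sigma>_def del: cycle_of_list.simps)
    have v: "v = v'" using x.support_i y.support_i unfolding eq by simp
    have "\<tau> z = \<tau>' z" for z
    proof (cases "z \<in> set (i # v)")
      case True
      then show ?thesis using x.\<tau> y.\<tau> by (auto simp: permutes_def v)
    next
      case False
      then show ?thesis using x.off_cycle y.off_cycle eq v by metis
    qed
    then show "x = y" using v by (auto simp: xy)
  qed simp
next
  let ?g = "\<lambda>(v, \<tau>). cycle_of_list (i # v) \<circ> \<tau>"
  fix x assume x: "x \<in> (SIGMA v:arrangements (S - {i}). {\<tau>. \<tau> permutes (S - {i} - set v)})"
  obtain v \<tau> where xy: "x = (v, \<tau>)" by (cases x) auto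
  interpret x: glued_permutation S i v \<tau> using x assms by unfold_locales (auto simp: xy)
  show "?g x \<in> {\<sigma>. \<sigma> permutes S}" using x.permutes
    by (simp add: xy x.\<sigma>_def del: cycle_of_list.simps)
next
  let ?g = "\<lambda>(v, \<tau>). cycle_of_list (i # v) \<circ> \<tau>"
  fix \<sigma> assume "\<sigma> \<in> {\<sigma>. \<sigma> permutes S}"
  then have \<sigma>: "\<sigma> permutes S" by simp
  have perm: "permutation \<sigma>" using \<sigma> assms(1) by (rule permutes_finite_imp_permutation)
  define v where "v = tl (support \<sigma> i)"
  define \<tau> where "\<tau> = (\<lambda>y. if y \<in> S - set (support \<sigma> i) then \<sigma> y else y)"
  have pos: "least_power \<sigma> i > 0" using least_power_of_permutation[OF perm] by blast
  then have ne: "support \<sigma> i \<noteq> []" by simp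
  have hd: "hd (support \<sigma> i) = i" using pos by (simp add: hd_map)
  have iv: "support \<sigma> i = i # v" using ne hd unfolding v_def by (metis list.collapse)
  have sub: "set (support \<sigma> i) \<subseteq> S"
    using assms(2) permutes_in_image[OF permutes_funpow[OF \<sigma>]] by auto
  have v: "v \<in> arrangements (S - {i})"
    using cycle_of_permutation[OF perm, of i] sub unfolding iv arrangements_def by auto
  have "\<tau> permutes (S - set (support \<sigma> i))"
    unfolding \<tau>_def using semidecomposition[OF \<sigma> assms(1)] .
  moreover have "S - set (support \<sigma> i) = S - {i} - set v" unfolding iv by auto
  ultimately have \<tau>: "\<tau> permutes (S - {i} - set v)" by simp
  interpret x: glued_permutation S i v \<tau> using v \<tau> assms by unfold_locales auto
  have "x.\<sigma> z = \<sigma> z" for z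
  proof (cases "z \<in> set (i # v)")
    case True
    then show ?thesis using x.on_cycle cycle_restrict[OF perm, of z i] unfolding iv by simp
  next
    case False
    then have "x.\<sigma> z = \<tau> z" by (rule x.off_cycle)
    also have "\<dots> = \<sigma> z" using False \<sigma> unfolding \<tau>_def iv by (auto simp: permutes_def)
    finally show ?thesis .
  qed
  then have "\<sigma> = ?g (v, \<tau>)" by (auto simp: x.\<sigma>_def fun_eq_iff)
  then show "\<exists>x \<in> (SIGMA v:arrangements (S - {i}). {\<tau>. \<tau> permutes (S - {i} - set v)}). \<sigma> = ?g x"
    using v \<tau> by blast
qed

lemma sum_permutations_by_cycle:
  fixes S :: "nat set"
  assumes "finite S" "i \<in> S"
  shows "(\<Sum>\<sigma> | \<sigma> permutes S. f \<sigma>) =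
    (\<Sum>v\<in>arrangements (S - {i}). \<Sum>\<tau> | \<tau> permutes (S - {i} - set v). f (cycle_of_list (i # v) \<circ> \<tau>))"
proof -
  have "(\<Sum>\<sigma> | \<sigma> permutes S. f \<sigma>) =
    (\<Sum>(v, \<tau>)\<in>(SIGMA v:arrangements (S - {i}). {\<tau>. \<tau> permutes (S - {i} - set v)}).
       f (cycle_of_list (i # v) \<circ> \<tau>))"
    by (subst sum.reindex_bij_betw[OF bij_betw_glued_permutations[OF assms], symmetric])
       (simp add: case_prod_beta)
  also have "\<dots> = (\<Sum>v\<in>arrangements (S - {i}). \<Sum>\<tau> | \<tau> permutes (S - {i} - set v).
      f (cycle_of_list (i # v) \<circ> \<tau>))"
    using assms by (subst sum.Sigma) (auto intro: finite_permutations)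
  finally show ?thesis .
qed

lemma rev_Cons_append: "rev (x # xs) = rev xs @ [x]"
  by simp

lemma sign_split:
  fixes w p :: quat
  shows "(- 1) ^ (l + k) * (w * p) = (- 1) ^ l * w * ((- 1) ^ k * p)"
    and "(- 1) ^ (l + k) * (p * w) = (- 1) ^ l * ((- 1) ^ k * p) * w"
  by (cases "even l"; cases "even k"; simp add: mult.assoc)+

text \<open>From here on permutations are replaced by lists: all later arguments on row determinants only use this
recursion and manipulate the list \<open>v\<close>.\<close>

theorem rdet_expand:
  assumes "finite S" "i \<in> S"
  shows "rdet S i M = (\<Sum>v\<in>arrangements (S - {i}).
    (- 1) ^ length v * walk M (i # v) i * row_minor M (S - {i} - set v))"
  unfolding rdet_def sum_permutations_by_cycle[OF assms]
proof (rule sum.cong[OF refl])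
  fix v assume v: "v \<in> arrangements (S - {i})"
  let ?T = "S - {i} - set v"
  let ?p = "\<lambda>\<tau>. prod_list (map (cycle_prod M \<tau>) (sorted_list_of_set (cycle_mins ?T \<tau>)))"
  have summand: "(- 1) ^ (card S - length (cycle_starts S i (cycle_of_list (i # v) \<circ> \<tau>))) *
      prod_list (map (cycle_prod M (cycle_of_list (i # v) \<circ> \<tau>))
        (cycle_starts S i (cycle_of_list (i # v) \<circ> \<tau>))) =
      (- 1) ^ length v * walk M (i # v) i * ((- 1) ^ (card ?T - card (cycle_mins ?T \<tau>)) * ?p \<tau>)"
    if "\<tau> permutes ?T" for \<tau>
  proof -
    interpret glued_permutation S i v \<tau> using v that assms by unfold_locales auto
    have fin: "finite (cycle_mins ?T \<tau>)" using assms(1) by (simp add: cycle_mins_def)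
    have "map (cycle_prod M \<sigma>) (sorted_list_of_set (cycle_mins ?T \<tau>)) =
        map (cycle_prod M \<tau>) (sorted_list_of_set (cycle_mins ?T \<tau>))"
      using fin prod_rest by (intro map_cong) auto
    then have "prod_list (map (cycle_prod M \<sigma>) (cycle_starts S i \<sigma>)) = walk M (i # v) i * ?p \<tau>"
      by (simp only: starts prod_i list.map prod_list.Cons)
    then show ?thesis unfolding \<sigma>_def[symmetric] by (simp only: sign sign_split(1))
  qed
  show "(\<Sum>\<tau> | \<tau> permutes ?T. (- 1) ^ (card S - length (cycle_starts S i (cycle_of_list (i # v) \<circ> \<tau>))) *
      prod_list (map (cycle_prod M (cycle_of_list (i # v) \<circ> \<tau>))
        (cycle_starts S i (cycle_of_list (i # v) \<circ> \<tau>)))) =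
      (- 1) ^ length v * walk M (i # v) i * row_minor M ?T"
    unfolding row_minor_def sum_distrib_left by (rule sum.cong[OF refl], rule summand, simp)
qed

theorem cdet_expand:
  assumes "finite S" "i \<in> S"
  shows "cdet S i M = (\<Sum>v\<in>arrangements (S - {i}).
    (- 1) ^ length v * column_minor M (S - {i} - set v) * walk M (i # v) i)"
  unfolding cdet_def sum_permutations_by_cycle[OF assms]
proof (rule sum.cong[OF refl])
  fix v assume v: "v \<in> arrangements (S - {i})"
  let ?T = "S - {i} - set v"
  let ?p = "\<lambda>\<tau>. prod_list (map (cycle_prod M \<tau>) (rev (sorted_list_of_set (cycle_mins ?T \<tau>))))"
  have summand: "(- 1) ^ (card S - length (cycle_starts S i (cycle_of_list (i # v) \<circ> \<tau>))) *
      prod_list (map (cycle_prod M (cycle_of_list (i # v) \<circ> \<tau>))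
        (rev (cycle_starts S i (cycle_of_list (i # v) \<circ> \<tau>)))) =
      (- 1) ^ length v * ((- 1) ^ (card ?T - card (cycle_mins ?T \<tau>)) * ?p \<tau>) * walk M (i # v) i"
    if "\<tau> permutes ?T" for \<tau>
  proof -
    interpret glued_permutation S i v \<tau> using v that assms by unfold_locales auto
    have fin: "finite (cycle_mins ?T \<tau>)" using assms(1) by (simp add: cycle_mins_def)
    have "map (cycle_prod M \<sigma>) (rev (sorted_list_of_set (cycle_mins ?T \<tau>))) =
        map (cycle_prod M \<tau>) (rev (sorted_list_of_set (cycle_mins ?T \<tau>)))"
      using fin prod_rest by (intro map_cong) auto
    then have "prod_list (map (cycle_prod M \<sigma>) (rev (cycle_starts S i \<sigma>))) = ?p \<tau> * walk M (i # v) i"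
      by (simp only: starts prod_i rev_Cons_append list.map map_append prod_list.append
          prod_list.Cons prod_list.Nil mult_1_right)
    then show ?thesis unfolding \<sigma>_def[symmetric] by (simp only: sign sign_split(2))
  qed
  show "(\<Sum>\<tau> | \<tau> permutes ?T. (- 1) ^ (card S - length (cycle_starts S i (cycle_of_list (i # v) \<circ> \<tau>))) *
      prod_list (map (cycle_prod M (cycle_of_list (i # v) \<circ> \<tau>))
        (rev (cycle_starts S i (cycle_of_list (i # v) \<circ> \<tau>))))) =
      (- 1) ^ length v * column_minor M ?T * walk M (i # v) i"
    unfolding column_minor_def sum_distrib_left sum_distrib_right
    by (rule sum.cong[OF refl], rule summand, simp)
qed

text \<open>The smallest element of \<open>S\<close> is the smallest element of its own cycle and precedes all other starts,
so for \<open>i = Min S\<close> the special role of the first cycle disappears.\<close>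

lemma cycle_starts_Min:
  assumes "finite S" "S \<noteq> {}" "\<tau> permutes S"
  shows "cycle_starts S (Min S) \<tau> = sorted_list_of_set (cycle_mins S \<tau>)"
proof -
  let ?m = "Min S"
  have perm: "permutation \<tau>" using assms(3,1) by (rule permutes_finite_imp_permutation)
  have mS: "?m \<in> S" using assms by simp
  have fin: "finite (orbit \<tau> s)" for s
    using finite_orbit[OF permutation_self_in_orbit[OF perm]] .
  have in_orbit: "Min (orbit \<tau> s) \<in> orbit \<tau> s" for s
    using fin orbit_nonempty by (rule Min_in)
  have sub: "orbit \<tau> s \<subseteq> S" if "s \<in> S" for s using permutes_orbit_subset[OF assms(3) that] .
  have char: "Min (orbit \<tau> s) = ?m \<longleftrightarrow> ?m \<in> orbit \<tau> s" if "s \<in> S" for s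
    using in_orbit[of s] sub[OF that] fin[of s] mS assms(1)
    by (metis Min.boundedE Min_antimono Min_in Min_le empty_iff order_antisym)
  have "?m \<in> cycle_mins S \<tau>"
    using char[OF mS] permutation_self_in_orbit[OF perm] mS unfolding cycle_mins_def
    by (metis image_eqI)
  moreover have "cycle_mins S \<tau> \<subseteq> S" using in_orbit sub unfolding cycle_mins_def by blast
  ultimately have min: "Min (cycle_mins S \<tau>) = ?m"
    using assms(1) by (metis Min_antimono Min_le antisym_conv empty_iff finite_subset)
  have "{Min (orbit \<tau> s) | s. s \<in> S \<and> ?m \<notin> orbit \<tau> s} = cycle_mins S \<tau> - {?m}"
    using char unfolding cycle_mins_def by auto
  then show ?thesis
    using sorted_list_of_set_nonempty[of "cycle_mins S \<tau>"] assms \<open>?m \<in> cycle_mins S \<tau>\<close>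
    unfolding cycle_starts_def min by (auto simp: cycle_mins_def)
qed

lemma row_minor_eq_rdet:
  assumes "finite S" "S \<noteq> {}" shows "row_minor M S = rdet S (Min S) M"
  unfolding row_minor_def rdet_def
  by (rule sum.cong[OF refl])
     (simp only: mem_Collect_eq cycle_starts_Min[OF assms]
        sorted_list_of_set.length_sorted_key_list_of_set)

lemma column_minor_eq_cdet:
  assumes "finite S" "S \<noteq> {}" shows "column_minor M S = cdet S (Min S) M"
  unfolding column_minor_def cdet_def
  by (rule sum.cong[OF refl])
     (simp only: mem_Collect_eq cycle_starts_Min[OF assms]
        sorted_list_of_set.length_sorted_key_list_of_set)

lemma row_minor_empty [simp]: "row_minor M {} = 1"
  and column_minor_empty [simp]: "column_minor M {} = 1"
  by (simp_all add: row_minor_def column_minor_def cycle_mins_def)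

section \<open>Sums over lists of distinct elements\<close>

lemma of_real_quat: "(of_real r :: quat) = Quat r 0 0 0"
  by (simp add: of_real_def scaleR_quat_def one_quat_def)

lemma qcnj_simps [simp]:
  "qcnj 0 = 0" "qcnj 1 = 1" "qcnj (of_real r) = of_real r" "qcnj (- x) = - qcnj x"
  "qcnj (x + y) = qcnj x + qcnj y" "qcnj (qcnj x) = x"
  by (simp_all add: qcnj_def of_real_quat quat_eq_iff plus_quat_def uminus_quat_def zero_quat_def one_quat_def)

lemma qcnj_mult: "qcnj (x * y) = qcnj y * qcnj x"
  by (simp add: qcnj_def times_quat_def quat_eq_iff algebra_simps)

lemma qcnj_sum: "qcnj (sum f A) = (\<Sum>x\<in>A. qcnj (f x))"
  by (induction A rule: infinite_finite_induct) auto

lemma qcnj_sign [simp]: "qcnj ((- 1) ^ l) = (- 1) ^ l"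
  by (cases "even l") auto

lemma qre_simps [simp]:
  "qre 0 = 0" "qre 1 = 1" "qre (of_real r) = r" "qre (- x) = - qre x" "qre (x + y) = qre x + qre y"
  "qre (x - y) = qre x - qre y"
  by (simp_all add: of_real_quat plus_quat_def minus_quat_def uminus_quat_def zero_quat_def one_quat_def)

lemma qre_sum: "qre (sum f A) = (\<Sum>x\<in>A. qre (f x))"
  by (induction A rule: infinite_finite_induct) auto

lemma qre_mult_commute: "qre (x * y) = qre (y * x)"
  by (simp add: times_quat_def)

lemma qre_mult_of_real [simp]: "qre (x * of_real r) = qre x * r" "qre (of_real r * x) = r * qre x"
  by (simp_all add: times_quat_def of_real_quat)

lemma qre_sign [simp]: "qre ((- 1) ^ l * x) = (- 1) ^ l * qre x"
  by (cases "even l") auto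

lemma of_real_central: "of_real r * x = x * (of_real r :: quat)"
  by (simp add: times_quat_def of_real_quat quat_eq_iff)

lemma qcnj_signed_real: "qcnj ((- 1) ^ l * w * of_real r) = (- 1) ^ l * qcnj w * of_real r"
  by (cases "even l") (simp_all add: qcnj_mult of_real_central[of r "qcnj w"])

lemma qcnj_fixed_iff: "qcnj x = x \<longleftrightarrow> x = of_real (qre x)"
  by (auto simp: qcnj_def of_real_quat quat_eq_iff)

lemma Nil_arrangements: "[] \<in> arrangements T"
  by (simp add: arrangements_def)

lemma hd_arrangement: "v \<in> arrangements (S - {j}) \<Longrightarrow> j \<in> S \<Longrightarrow> hd (v @ [j]) \<in> S"
  by (cases v) (auto simp: arrangements_def)

lemma arrangements_Diff: "arrangements (T - A) = {v \<in> arrangements T. set v \<inter> A = {}}"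
  by (auto simp: arrangements_def)

text \<open>A list that contains \<open>j\<close> is cut at \<open>j\<close> into two disjoint lists. This one identity drives both the
independence of the row determinant from the row and its vanishing for two equal rows.\<close>

lemma sum_arrangements_insert:
  assumes "finite T" "j \<notin> T"
  shows "(\<Sum>v\<in>arrangements (insert j T). f v) = (\<Sum>v\<in>arrangements T. f v) +
    (\<Sum>a\<in>arrangements T. \<Sum>b\<in>arrangements (T - set a). f (a @ j # b))"
proof -
  let ?P = "SIGMA a:arrangements T. arrangements (T - set a)"
  let ?g = "\<lambda>(a, b). a @ j # b"
  have inj: "inj_on ?g ?P"
  proof (rule inj_onI)
    fix x y assume "x \<in> ?P" "y \<in> ?P" "?g x = ?g y"
    moreover obtain a b a' b' where xy: "x = (a, b)" "y = (a', b')" by (cases x, cases y) auto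
    ultimately have "j \<notin> set a" "j \<notin> set b" "a @ j # b = a' @ j # b'"
      using assms(2) by (auto simp: arrangements_def)
    then show "x = y" by (simp add: xy append_Cons_eq_iff)
  qed
  have img: "?g ` ?P = {v \<in> arrangements (insert j T). j \<in> set v}"
  proof (intro equalityI subsetI)
    fix v assume "v \<in> {v \<in> arrangements (insert j T). j \<in> set v}"
    then have v: "distinct v" "set v \<subseteq> insert j T" "j \<in> set v" by (auto simp: arrangements_def)
    obtain a b where ab: "v = a @ j # b" using split_list[OF v(3)] by blast
    then have "(a, b) \<in> ?P" using v assms(2) by (auto simp: arrangements_def)
    then show "v \<in> ?g ` ?P" using ab by force
  qed (use assms in \<open>auto simp: arrangements_def\<close>)
  have "arrangements (insert j T) = arrangements T \<union> ?g ` ?P"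
    unfolding img by (auto simp: arrangements_def)
  moreover have "arrangements T \<inter> ?g ` ?P = {}"
    unfolding img using assms(2) by (auto simp: arrangements_def)
  moreover have fin: "finite ?P" using assms(1) by auto
  ultimately have "(\<Sum>v\<in>arrangements (insert j T). f v) =
      (\<Sum>v\<in>arrangements T. f v) + (\<Sum>v\<in>?g ` ?P. f v)"
    using assms(1) by (simp add: sum.union_disjoint)
  also have "(\<Sum>v\<in>?g ` ?P. f v) = (\<Sum>(a, b)\<in>?P. f (a @ j # b))"
    by (subst sum.reindex[OF inj]) (simp add: case_prod_beta)
  also have "\<dots> = (\<Sum>a\<in>arrangements T. \<Sum>b\<in>arrangements (T - set a). f (a @ j # b))"
    using assms(1) by (subst sum.Sigma) auto
  finally show ?thesis .
qed

lemma sum_arrangements_swap: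
  assumes "finite T"
  shows "(\<Sum>a\<in>arrangements T. \<Sum>b\<in>arrangements (T - set a). g a b) =
    (\<Sum>b\<in>arrangements T. \<Sum>a\<in>arrangements (T - set b). g a b)"
proof -
  have "(\<Sum>a\<in>arrangements T. \<Sum>b | b \<in> arrangements T \<and> set a \<inter> set b = {}. g a b) =
      (\<Sum>b\<in>arrangements T. \<Sum>a | a \<in> arrangements T \<and> set a \<inter> set b = {}. g a b)"
    using assms by (intro sum.swap_restrict) auto
  then show ?thesis by (simp add: arrangements_Diff Int_commute)
qed

lemma sum_arrangements_rev: "(\<Sum>v\<in>arrangements T. f v) = (\<Sum>v\<in>arrangements T. f (rev v))"
  by (rule sum.reindex_bij_witness[where i = rev and j = rev]) (auto simp: arrangements_def)

section \<open>Row determinants of Hermitian matrices\<close>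

definition hermitian_on :: "nat set \<Rightarrow> quat mat \<Rightarrow> bool" where
  "hermitian_on S M \<longleftrightarrow> (\<forall>p\<in>S. \<forall>q\<in>S. M $$ (q, p) = qcnj (M $$ (p, q)))"

lemma hermitian_onD: "hermitian_on S M \<Longrightarrow> p \<in> S \<Longrightarrow> q \<in> S \<Longrightarrow> qcnj (M $$ (p, q)) = M $$ (q, p)"
  by (metis hermitian_on_def)

lemma hermitian_on_subset: "hermitian_on S M \<Longrightarrow> T \<subseteq> S \<Longrightarrow> hermitian_on T M"
  by (auto simp: hermitian_on_def)

lemma walk_append: "walk M (xs @ ys) z = walk M xs (hd (ys @ [z])) * walk M ys z"
proof (induction xs)
  case (Cons x xs)
  then show ?case by (cases xs; cases ys) (auto simp: mult.assoc)
qed simp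

lemma walk_cong:
  assumes "\<And>x y. x \<in> set xs \<Longrightarrow> y \<in> insert z (set xs) \<Longrightarrow> M $$ (x, y) = M' $$ (x, y)"
  shows "walk M xs z = walk M' xs z"
  using assms
proof (induction xs)
  case (Cons x xs)
  have "hd (xs @ [z]) \<in> insert z (set (x # xs))" by (cases xs) auto
  then have "M $$ (x, hd (xs @ [z])) = M' $$ (x, hd (xs @ [z]))" by (intro Cons.prems) auto
  moreover have "walk M xs z = walk M' xs z" by (intro Cons.IH Cons.prems) auto
  ultimately show ?case by simp
qed simp

text \<open>Conjugation reverses the order of the factors and transposes each of them.\<close>

lemma qcnj_walk:
  assumes "hermitian_on S M" "x \<in> S" "y \<in> S" "set xs \<subseteq> S"
  shows "qcnj (walk M (x # xs) y) = walk M (y # rev xs) x"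
  using assms(2-)
proof (induction xs arbitrary: x)
  case Nil
  then show ?case using hermitian_onD[OF assms(1)] by simp
next
  case (Cons z zs)
  have "qcnj (walk M (x # z # zs) y) = qcnj (walk M (z # zs) y) * qcnj (M $$ (x, z))"
    by (simp add: qcnj_mult)
  also have "\<dots> = walk M (y # rev zs) z * M $$ (z, x)"
    using Cons hermitian_onD[OF assms(1)] by simp
  also have "\<dots> = walk M ((y # rev zs) @ [z]) x"
    by (subst walk_append) simp
  finally show ?case by simp
qed

lemma row_minor_cong:
  assumes "finite S" "\<And>p q. p \<in> S \<Longrightarrow> q \<in> S \<Longrightarrow> M $$ (p, q) = M' $$ (p, q)"
  shows "row_minor M S = row_minor M' S"
  using assms
proof (induction S rule: finite_psubset_induct)
  case (psubset S)
  show ?case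
  proof (cases "S = {}")
    case False
    let ?i = "Min S"
    have i: "?i \<in> S" using False psubset.hyps by simp
    have "row_minor M (S - {?i} - set v) = row_minor M' (S - {?i} - set v)" for v
      using i by (intro psubset.IH) (auto intro: psubset.prems)
    moreover have "walk M (?i # v) ?i = walk M' (?i # v) ?i" if "v \<in> arrangements (S - {?i})" for v
      using i that by (intro walk_cong psubset.prems) (auto simp: arrangements_def)
    ultimately show ?thesis
      unfolding row_minor_eq_rdet[OF psubset.hyps False] rdet_expand[OF psubset.hyps i]
      by (intro sum.cong) simp_all
  qed simp
qed

lemma qre_rdet_expand:
  assumes "finite S" "i \<in> S" "\<And>T. T \<subset> S \<Longrightarrow> row_minor M T = of_real (d T)"
  shows "qre (rdet S i M) = (\<Sum>v\<in>arrangements (S - {i}).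
    (- 1) ^ length v * qre (walk M (i # v) i) * d (S - {i} - set v))"
proof -
  have "qre ((- 1) ^ length v * walk M (i # v) i * row_minor M (S - {i} - set v)) =
      (- 1) ^ length v * qre (walk M (i # v) i) * d (S - {i} - set v)" for v
  proof -
    have "S - {i} - set v \<subset> S" using assms(2) by blast
    from assms(3)[OF this] show ?thesis by (simp only: mult.assoc qre_sign qre_mult_of_real)
  qed
  then show ?thesis unfolding rdet_expand[OF assms(1,2)] qre_sum by simp
qed

text \<open>Induction over \<open>S\<close>. Reversing the cycle through \<open>i\<close> conjugates its product and keeps the real cofactor, so
\<open>rdet S i M\<close> equals its conjugate. Being real, it may be computed with real parts, which are invariant
under cyclic shifts. A permutation either has \<open>i\<close> and \<open>j\<close> on different cycles, giving the symmetric sum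
\<open>E i j\<close>, or on one cycle, which is cut at \<open>i\<close> and \<open>j\<close> and gives the symmetric sum \<open>F i j\<close>. The column
determinant has the cofactor on the other side of the cycle product, which makes no difference as the
cofactor is real.\<close>

lemma hermitian_minors:
  assumes "finite S" "hermitian_on S M"
  shows "row_minor M S = of_real (qre (row_minor M S)) \<and> column_minor M S = row_minor M S \<and>
    (\<forall>i\<in>S. rdet S i M = row_minor M S \<and> cdet S i M = row_minor M S)"
  using assms
proof (induction S rule: finite_psubset_induct)
  case (psubset S)
  note fin = psubset.hyps
  define d where "d = (\<lambda>T. qre (row_minor M T))"
  have IH: "row_minor M T = of_real (d T)" "column_minor M T = of_real (d T)"
    "\<And>j. j \<in> T \<Longrightarrow> rdet T j M = of_real (d T)" if "T \<subset> S" for T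
    using psubset.IH[OF that hermitian_on_subset[OF psubset.prems]] that
    unfolding d_def by auto
  have lt: "S - {i} - set v \<subset> S" if "i \<in> S" for i v using that by blast
  have real: "rdet S i M = of_real (qre (rdet S i M))" if i: "i \<in> S" for i
  proof -
    let ?f = "\<lambda>v. (- 1) ^ length v * walk M (i # v) i * of_real (d (S - {i} - set v))"
    have exp: "rdet S i M = (\<Sum>v\<in>arrangements (S - {i}). ?f v)"
      unfolding rdet_expand[OF fin i] by (simp only: IH(1)[OF lt[OF i]])
    have "qcnj (?f v) = ?f (rev v)" if "v \<in> arrangements (S - {i})" for v
    proof -
      have "set v \<subseteq> S" using that by (auto simp: arrangements_def)
      from qcnj_walk[OF psubset.prems i i this] show ?thesis
        by (simp only: qcnj_signed_real length_rev set_rev)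
    qed
    then have "qcnj (rdet S i M) = (\<Sum>v\<in>arrangements (S - {i}). ?f (rev v))"
      unfolding exp qcnj_sum by (intro sum.cong) auto
    also have "\<dots> = rdet S i M" unfolding exp by (rule sum_arrangements_rev[symmetric])
    finally show ?thesis unfolding qcnj_fixed_iff .
  qed
  have col: "cdet S i M = rdet S i M" if i: "i \<in> S" for i
    unfolding rdet_expand[OF fin i] cdet_expand[OF fin i]
    unfolding IH(1,2)[OF lt[OF i]] mult.assoc
    by (rule sum.cong[OF refl], subst of_real_central) (rule refl)
  have re_eq: "qre (rdet S i M) = qre (rdet S j M)" if ij: "i \<in> S" "j \<in> S" "i \<noteq> j" for i j
  proof -
    define T where "T = S - {i, j}"
    have T: "finite T" "i \<notin> T" "j \<notin> T" using fin by (auto simp: T_def)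
    define E where "E = (\<lambda>i j. (\<Sum>v\<in>arrangements T. \<Sum>w\<in>arrangements (T - set v).
        (- 1) ^ (length v + length w) * qre (walk M (i # v) i) * qre (walk M (j # w) j) * d (T - set v - set w)))"
    define F where "F = (\<lambda>i j. (\<Sum>a\<in>arrangements T. \<Sum>b\<in>arrangements (T - set a).
        - ((- 1) ^ (length a + length b) * qre (walk M (i # a) j * walk M (j # b) i) * d (T - set a - set b))))"
    have split: "qre (rdet S i M) = E i j + F i j"
      if ij: "i \<in> S" "j \<in> S" "i \<noteq> j" "T = S - {i, j}" for i j
    proof -
      have ins: "S - {i} = insert j T" and jT: "j \<notin> T" and iT: "i \<notin> T" using ij by auto
      define g where "g = (\<lambda>v. (- 1) ^ length v * qre (walk M (i # v) i) * d (S - {i} - set v))"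
      have disjoint: "g v = (\<Sum>w\<in>arrangements (T - set v). (- 1) ^ (length v + length w) * qre (walk M (i # v) i) *
            qre (walk M (j # w) j) * d (T - set v - set w))" if v: "v \<in> arrangements T" for v
      proof -
        let ?R = "S - {i} - set v"
        have jR: "j \<in> ?R" using v jT ij by (auto simp: arrangements_def)
        have RT: "?R - {j} = T - set v" using ij v by (auto simp: arrangements_def)
        have sub: "?R \<subset> S" by (rule lt[OF ij(1)])
        have "d ?R = qre (rdet ?R j M)" using IH(3)[OF sub jR] by simp
        also have "\<dots> = (\<Sum>w\<in>arrangements (?R - {j}).
            (- 1) ^ length w * qre (walk M (j # w) j) * d (?R - {j} - set w))"
          using fin sub by (intro qre_rdet_expand jR IH(1)) auto
        finally show ?thesis unfolding RT g_def
          by (simp add: sum_distrib_left power_add mult_ac del: walk.simps)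
      qed
      have joint: "g (a @ j # b) =
          - ((- 1) ^ (length a + length b) * qre (walk M (i # a) j * walk M (j # b) i) * d (T - set a - set b))" for a b
      proof -
        have "S - {i} - set (a @ j # b) = T - set a - set b" using ij by auto
        then show ?thesis using walk_append[of M "i # a" "j # b" i] unfolding g_def
          by (simp del: walk.simps)
      qed
      have "qre (rdet S i M) = (\<Sum>v\<in>arrangements (S - {i}). g v)"
        unfolding g_def by (rule qre_rdet_expand[OF fin ij(1) IH(1)])
      then show ?thesis
        unfolding ins sum_arrangements_insert[OF T(1) jT] E_def F_def
        by (simp only: disjoint joint cong: sum.cong)
    qed
    have comm: "T - set v - set w = T - set w - set v" for v w by auto
    have "E i j = E j i"
      unfolding E_def by (subst sum_arrangements_swap[OF T(1)])
        (simp add: mult_ac add.commute comm del: walk.simps)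
    moreover have "F i j = F j i"
      unfolding F_def by (subst sum_arrangements_swap[OF T(1)])
        (simp add: qre_mult_commute[of "walk M (i # _) j"] add.commute comm del: walk.simps)
    moreover have "T = S - {j, i}" by (auto simp: T_def)
    ultimately show ?thesis using split[of i j] split[of j i] ij by (simp add: T_def)
  qed
  show ?case
  proof (cases "S = {}")
    case False
    have m: "Min S \<in> S" using fin False by simp
    have same: "rdet S i M = rdet S (Min S) M" if "i \<in> S" for i
    proof -
      have "qre (rdet S i M) = qre (rdet S (Min S) M)"
        using re_eq[OF that m] by (cases "i = Min S") auto
      then show ?thesis using trans[OF real[OF that]] real[OF m, symmetric] by simp
    qed
    show ?thesis
      unfolding row_minor_eq_rdet[OF fin False] column_minor_eq_cdet[OF fin False]
      by (intro conjI ballI real[OF m] col[OF m]) (rule same, assumption, rule trans[OF col same])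
  qed simp
qed

lemma row_minor_real: "finite S \<Longrightarrow> hermitian_on S M \<Longrightarrow> row_minor M S = of_real (qre (row_minor M S))"
  and rdet_hermitian: "finite S \<Longrightarrow> hermitian_on S M \<Longrightarrow> i \<in> S \<Longrightarrow> rdet S i M = row_minor M S"
  and cdet_hermitian: "finite S \<Longrightarrow> hermitian_on S M \<Longrightarrow> i \<in> S \<Longrightarrow> cdet S i M = row_minor M S"
  using hermitian_minors by blast+

lemma hdet_eq_row_minor:
  assumes "finite S" "S \<noteq> {}" "hermitian_on S M"
  shows "hdet S M = qre (row_minor M S)"
  unfolding hdet_def
proof (rule the_equality)
  show "\<forall>i\<in>S. rdet S i M = of_real (qre (row_minor M S)) \<and> cdet S i M = of_real (qre (row_minor M S))"
    using trans[OF rdet_hermitian row_minor_real] trans[OF cdet_hermitian row_minor_real] assms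
    by blast
  fix x assume x: "\<forall>i\<in>S. rdet S i M = of_real x \<and> cdet S i M = of_real x"
  obtain i where i: "i \<in> S" using assms(2) by blast
  then have "row_minor M S = of_real x" using x rdet_hermitian[OF assms(1,3) i] by auto
  then show "x = qre (row_minor M S)" by simp
qed

section \<open>Replacing a row\<close>

lemma rdet_replace_row:
  assumes "finite S" "j \<in> S" "S \<subseteq> {..<dim_row M}" "S \<subseteq> {..<dim_col M}"
  shows "rdet S j (replace_row M j b) = (\<Sum>v\<in>arrangements (S - {j}).
    (- 1) ^ length v * (b $ hd (v @ [j]) * walk M v j) * row_minor M (S - {j} - set v))"
  unfolding rdet_expand[OF assms(1,2)]
proof (rule sum.cong[OF refl])
  fix v assume "v \<in> arrangements (S - {j})"
  then have v: "set v \<subseteq> S - {j}" by (simp add: arrangements_def)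
  have other: "replace_row M j b $$ (p, q) = M $$ (p, q)" if "p \<in> S - {j}" "q \<in> S" for p q
  proof -
    have "p < dim_row M" "q < dim_col M" using that assms by auto
    then show ?thesis using that by (simp add: replace_row_def)
  qed
  have "row_minor (replace_row M j b) (S - {j} - set v) = row_minor M (S - {j} - set v)"
    using assms(1) by (intro row_minor_cong other) auto
  moreover have "walk (replace_row M j b) v j = walk M v j"
    using v assms(2) by (intro walk_cong other) auto
  moreover have "replace_row M j b $$ (j, hd (v @ [j])) = b $ hd (v @ [j])"
  proof -
    have "hd (v @ [j]) \<in> S" using v assms(2) by (cases v) auto
    then have "hd (v @ [j]) < dim_col M" "j < dim_row M" using assms by auto
    then show ?thesis by (simp add: replace_row_def)
  qed
  ultimately show "(- 1) ^ length v * walk (replace_row M j b) (j # v) j *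
      row_minor (replace_row M j b) (S - {j} - set v) =
      (- 1) ^ length v * (b $ hd (v @ [j]) * walk M v j) * row_minor M (S - {j} - set v)"
    by simp
qed

lemma rdet_replace_row_linear:
  assumes "finite S" "j \<in> S" "S \<subseteq> {..<n}" "M \<in> carrier_mat n n"
  shows "rdet S j (replace_row M j b) = (\<Sum>l<n. b $ l * rdet S j (replace_row M j (unit_vec n l)))"
proof -
  have S: "S \<subseteq> {..<dim_row M}" "S \<subseteq> {..<dim_col M}" using assms by auto
  let ?w = "\<lambda>v c. (- 1) ^ length v * (c * walk M v j) * row_minor M (S - {j} - set v)"
  have "?w v (b $ hd (v @ [j])) = (\<Sum>l<n. b $ l * ?w v (unit_vec n l $ hd (v @ [j])))"
    if "v \<in> arrangements (S - {j})" for v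
  proof -
    let ?h = "hd (v @ [j])"
    have "?h \<in> S" using that assms(2) by (rule hd_arrangement)
    then have h: "?h < n" using assms(3) by auto
    have "(\<Sum>l<n. b $ l * ?w v (unit_vec n l $ ?h)) = (\<Sum>l<n. if l = ?h then b $ l * ?w v 1 else 0)"
      using h by (intro sum.cong) auto
    also have "\<dots> = b $ ?h * ?w v 1" using h by simp
    also have "\<dots> = ?w v (b $ ?h)" by (cases "even (length v)") (simp_all add: mult.assoc)
    finally show ?thesis by simp
  qed
  then have "rdet S j (replace_row M j b) = (\<Sum>v\<in>arrangements (S - {j}).
      \<Sum>l<n. b $ l * ?w v (unit_vec n l $ hd (v @ [j])))"
    unfolding rdet_replace_row[OF assms(1,2) S] by (intro sum.cong) auto
  then show ?thesis
    unfolding rdet_replace_row[OF assms(1,2) S] sum_distrib_left by (subst sum.swap)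
qed

lemma rdet_replace_unit_self:
  assumes "finite S" "j \<in> S" "S \<subseteq> {..<n}" "M \<in> carrier_mat n n"
  shows "rdet S j (replace_row M j (unit_vec n j)) = row_minor M (S - {j})"
proof -
  have S: "S \<subseteq> {..<dim_row M}" "S \<subseteq> {..<dim_col M}" using assms by auto
  have j: "j < n" using assms by auto
  have "(- 1) ^ length v * (unit_vec n j $ hd (v @ [j]) * walk M v j) * row_minor M (S - {j} - set v) =
     (if v = [] then row_minor M (S - {j}) else 0)" if "v \<in> arrangements (S - {j})" for v
    using that j assms(3) by (cases v) (auto simp: arrangements_def)
  then have "rdet S j (replace_row M j (unit_vec n j)) =
      (\<Sum>v\<in>arrangements (S - {j}). if v = [] then row_minor M (S - {j}) else 0)"
    unfolding rdet_replace_row[OF assms(1,2) S] by (intro sum.cong) auto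
  also have "\<dots> = row_minor M (S - {j})"
    using assms(1) by (subst sum.delta) (simp_all add: Nil_arrangements)
  finally show ?thesis .
qed

lemma rdet_replace_unit_outside:
  assumes "finite S" "j \<in> S" "S \<subseteq> {..<n}" "M \<in> carrier_mat n n" "l \<notin> S" "l < n"
  shows "rdet S j (replace_row M j (unit_vec n l)) = 0"
proof -
  have S: "S \<subseteq> {..<dim_row M}" "S \<subseteq> {..<dim_col M}" using assms by auto
  have "unit_vec n l $ hd (v @ [j]) = (0 :: quat)" if "v \<in> arrangements (S - {j})" for v
  proof -
    have "hd (v @ [j]) \<in> S" using that assms(2) by (rule hd_arrangement)
    then have "hd (v @ [j]) < n" "hd (v @ [j]) \<noteq> l" using assms by auto
    then show ?thesis using assms(6) by simp
  qed
  then show ?thesis unfolding rdet_replace_row[OF assms(1,2) S] by (intro sum.neutral) auto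
qed

text \<open>Only the cycles \<open>j \<rightarrow> l \<rightarrow> \<dots>\<close> contribute on the left. Removing \<open>l\<close> from such a cycle merges the steps
\<open>j \<rightarrow> l \<rightarrow> p\<close> into one step \<open>j \<rightarrow> p\<close> with entry \<open>M (l, p)\<close>; the cycle gets shorter by one, which is
where the sign comes from.\<close>

lemma rdet_replace_unit_insert:
  assumes "finite S" "j \<in> S" "S \<subseteq> {..<n}" "M \<in> carrier_mat n n" "l \<notin> S" "l < n"
  shows "rdet (insert l S) j (replace_row M j (unit_vec n l)) = - rdet S j (replace_row M j (row M l))"
proof -
  have S: "S \<subseteq> {..<dim_row M}" "S \<subseteq> {..<dim_col M}" using assms by auto
  have S': "insert l S \<subseteq> {..<dim_row M}" "insert l S \<subseteq> {..<dim_col M}" using assms by auto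
  let ?T = "S - {j}"
  have ins: "insert l S - {j} = insert l ?T" using assms by auto
  have T: "finite ?T" "l \<notin> ?T" using assms by auto
  let ?f = "\<lambda>v. (- 1) ^ length v * (unit_vec n l $ hd (v @ [j]) * walk M v j) *
     row_minor M (insert l S - {j} - set v)"
  have off: "?f v = 0" if "v \<in> arrangements ?T" for v
  proof -
    have "hd (v @ [j]) \<in> S" using that assms(2) by (rule hd_arrangement)
    then have "hd (v @ [j]) < n" "hd (v @ [j]) \<noteq> l" using assms by auto
    then show ?thesis using assms(6) by simp
  qed
  have inner: "(\<Sum>b\<in>arrangements (?T - set a). ?f (a @ l # b)) =
     (if a = [] then \<Sum>b\<in>arrangements ?T. - ((- 1) ^ length b * walk M (l # b) j * row_minor M (?T - set b)) else 0)"
    if a: "a \<in> arrangements ?T" for a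
  proof (cases "a = []")
    case True
    have "insert l S - {j} - set (l # b) = ?T - set b" for b using T(2) by auto
    then show ?thesis using True assms(6) by (simp del: walk.simps)
  next
    case False
    then have "hd a \<in> S" using a by (cases a) (auto simp: arrangements_def)
    then have "hd a < n" "hd a \<noteq> l" using assms by auto
    then have "unit_vec n l $ hd ((a @ l # b) @ [j]) = (0 :: quat)" for b
      using False assms(6) by simp
    then show ?thesis using False by (simp only: mult_zero_left mult_zero_right sum.neutral_const if_False)
  qed
  have row: "row M l $ hd (b @ [j]) = M $$ (l, hd (b @ [j]))" if "b \<in> arrangements ?T" for b
  proof -
    have "hd (b @ [j]) \<in> S" using that assms(2) by (rule hd_arrangement)
    then have "hd (b @ [j]) < n" using assms by auto
    then show ?thesis using assms by simp
  qed
  have off_sum: "(\<Sum>v\<in>arrangements ?T. ?f v) = 0"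
    by (rule sum.neutral) (use off in blast)
  have "rdet (insert l S) j (replace_row M j (unit_vec n l)) = (\<Sum>v\<in>arrangements (insert l ?T). ?f v)"
    using rdet_replace_row[of "insert l S" j M] S' assms by (simp add: ins)
  also have "\<dots> = (\<Sum>a\<in>arrangements ?T. if a = [] then
      \<Sum>b\<in>arrangements ?T. - ((- 1) ^ length b * walk M (l # b) j * row_minor M (?T - set b)) else 0)"
    unfolding sum_arrangements_insert[OF T] off_sum add_0
    by (rule sum.cong[OF refl inner])
  also have "\<dots> = (\<Sum>b\<in>arrangements ?T. - ((- 1) ^ length b * walk M (l # b) j * row_minor M (?T - set b)))"
    using T(1) by (subst sum.delta) (simp_all add: Nil_arrangements)
  also have "\<dots> = - rdet S j (replace_row M j (row M l))"
    unfolding rdet_replace_row[OF assms(1,2) S] sum_negf[symmetric]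
    by (intro sum.cong) (simp_all add: row)
  finally show ?thesis .
qed

text \<open>The product along the cycle through \<open>j\<close> starts in row \<open>l\<close>. If the cycle returns to \<open>l\<close> after a list
\<open>a\<close>, the closed part \<open>l # a\<close> may be detached as a cycle of its own. The sum over all \<open>a\<close> is then the
expansion along \<open>l\<close> of the minor of the elements that are neither \<open>j\<close> nor on the rest \<open>b\<close> of the cycle.
This minor is real, hence commutes with the remaining factors, and the result cancels against the summand of
the list \<open>b\<close>, which avoids \<open>l\<close>; the sign differs since \<open>a @ l # b\<close> is one element longer than
\<open>a\<close> and \<open>b\<close> together.\<close>

lemma rdet_replace_by_other_row:
  assumes "finite S" "j \<in> S" "l \<in> S" "l \<noteq> j" "S \<subseteq> {..<n}" "M \<in> carrier_mat n n" "hermitian_on S M"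
  shows "rdet S j (replace_row M j (row M l)) = 0"
proof -
  have S: "S \<subseteq> {..<dim_row M}" "S \<subseteq> {..<dim_col M}" using assms by auto
  define T where "T = S - {j, l}"
  have T: "finite T" "l \<notin> T" "S - {j} = insert l T" using assms by (auto simp: T_def)
  let ?g = "\<lambda>v. (- 1) ^ length v * walk M (l # v) j * row_minor M (S - {j} - set v)"
  have "row M l $ hd (v @ [j]) * walk M v j = walk M (l # v) j" if "v \<in> arrangements (S - {j})" for v
  proof -
    have "hd (v @ [j]) \<in> S" using that assms(2) by (rule hd_arrangement)
    then have "hd (v @ [j]) < n" "l < n" using assms by auto
    then show ?thesis using assms(6) by simp
  qed
  then have "rdet S j (replace_row M j (row M l)) = (\<Sum>v\<in>arrangements (insert l T). ?g v)"
    unfolding rdet_replace_row[OF assms(1,2) S] T(3)[symmetric] by (intro sum.cong) auto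
  also have "\<dots> = (\<Sum>v\<in>arrangements T. ?g v) +
      (\<Sum>b\<in>arrangements T. \<Sum>a\<in>arrangements (T - set b). ?g (a @ l # b))"
    unfolding sum_arrangements_insert[OF T(1,2)] by (subst sum_arrangements_swap[OF T(1)]) simp
  also have "(\<Sum>b\<in>arrangements T. \<Sum>a\<in>arrangements (T - set b). ?g (a @ l # b)) =
      (\<Sum>b\<in>arrangements T. - ?g b)"
  proof (rule sum.cong[OF refl])
    fix b assume b: "b \<in> arrangements T"
    let ?R = "S - {j} - set b"
    have lR: "l \<in> ?R" using b assms T by (auto simp: arrangements_def)
    have R: "finite ?R" "hermitian_on ?R M" using assms(1,7) by (auto intro: hermitian_on_subset)
    have RT: "?R - {l} = T - set b" by (auto simp: T_def)
    have "?g (a @ l # b) = - ((- 1) ^ length a * walk M (l # a) l * row_minor M (?R - {l} - set a)) *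
        ((- 1) ^ length b * walk M (l # b) j)" (is "_ = ?h a * _") if "a \<in> arrangements (T - set b)" for a
    proof -
      have eq: "S - {j} - set (a @ l # b) = ?R - {l} - set a" by auto
      have "finite (?R - {l} - set a)" "hermitian_on (?R - {l} - set a) M"
        using assms(1,7) by (auto intro: hermitian_on_subset)
      then obtain r where r: "row_minor M (?R - {l} - set a) = of_real r"
        using row_minor_real by blast
      show ?thesis
        unfolding eq r using walk_append[of M "l # a" "l # b" j]
        by (cases "even (length a)"; cases "even (length b)")
           (simp_all add: of_real_central mult.assoc del: walk.simps)
    qed
    then have "(\<Sum>a\<in>arrangements (T - set b). ?g (a @ l # b)) =
        - (\<Sum>a\<in>arrangements (T - set b). (- 1) ^ length a * walk M (l # a) l * row_minor M (?R - {l} - set a)) *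
        ((- 1) ^ length b * walk M (l # b) j)"
      by (simp add: sum_distrib_right sum_negf del: walk.simps)
    also have "(\<Sum>a\<in>arrangements (T - set b). (- 1) ^ length a * walk M (l # a) l * row_minor M (?R - {l} - set a)) =
        rdet ?R l M"
      unfolding rdet_expand[OF R(1) lR] RT ..
    also have "\<dots> = of_real (qre (row_minor M ?R))"
      using rdet_hermitian[OF R lR] row_minor_real[OF R] by simp
    finally have "(\<Sum>a\<in>arrangements (T - set b). ?g (a @ l # b)) =
        - (of_real (qre (row_minor M ?R)) * ((- 1) ^ length b * walk M (l # b) j))"
      by (simp del: walk.simps of_real_mult)
    also have "\<dots> = - ?g b"
      by (subst of_real_central, subst row_minor_real[OF R, symmetric]) (rule refl)
    finally show "(\<Sum>a\<in>arrangements (T - set b). ?g (a @ l # b)) = - ?g b" .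
  qed
  finally show ?thesis by (simp add: sum_negf del: walk.simps)
qed

lemma replace_row_self: "replace_row M j (row M j) = M"
  by (rule eq_matI) (auto simp: replace_row_def)

section \<open>Quaternion matrices\<close>

lemma mat_assoc:
  fixes A B C :: "quat mat"
  assumes "dim_col A = dim_row B" "dim_col B = dim_row C"
  shows "A * B * C = A * (B * C)"
  by (rule assoc_mult_mat[of A "dim_row A" "dim_row B" B "dim_row C" C "dim_col C"]) (use assms in auto)

lemma index_mat_mult:
  assumes "i < dim_row A" "j < dim_col B" "dim_col A = dim_row B"
  shows "(A * B) $$ (i, j) = (\<Sum>k<dim_row B. A $$ (i, k) * B $$ (k, j))"
  using assms by (auto simp: scalar_prod_def lessThan_atLeast0 intro: sum.cong)

lemma mult_real_smult:
  fixes A B :: "quat mat"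
  assumes "dim_col A = dim_row B"
  shows "A * (of_real c \<cdot>\<^sub>m B) = of_real c \<cdot>\<^sub>m (A * B)"
proof (rule eq_matI)
  fix i j assume "i < dim_row (of_real c \<cdot>\<^sub>m (A * B))" "j < dim_col (of_real c \<cdot>\<^sub>m (A * B))"
  then have ij: "i < dim_row A" "j < dim_col B" by auto
  have "x * (of_real c * y) = of_real c * (x * y)" for x y :: quat
    using of_real_central[of c x] by (simp add: mult.assoc[symmetric])
  then show "(A * (of_real c \<cdot>\<^sub>m B)) $$ (i, j) = (of_real c \<cdot>\<^sub>m (A * B)) $$ (i, j)"
    using ij assms by (simp add: index_mat_mult sum_distrib_left del: index_mult_mat(1))
qed auto

lemma real_smult_mult:
  fixes A B :: "quat mat"
  assumes "dim_col A = dim_row B"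
  shows "(of_real c \<cdot>\<^sub>m A) * B = of_real c \<cdot>\<^sub>m (A * B)"
proof (rule eq_matI)
  fix i j assume "i < dim_row (of_real c \<cdot>\<^sub>m (A * B))" "j < dim_col (of_real c \<cdot>\<^sub>m (A * B))"
  then have ij: "i < dim_row A" "j < dim_col B" by auto
  then show "((of_real c \<cdot>\<^sub>m A) * B) $$ (i, j) = (of_real c \<cdot>\<^sub>m (A * B)) $$ (i, j)"
    using assms by (simp add: index_mat_mult sum_distrib_left mult.assoc del: index_mult_mat(1))
qed auto

lemma pow_mat_Suc_left: "A \<in> carrier_mat n n \<Longrightarrow> A ^\<^sub>m Suc k = A * A ^\<^sub>m k" for A :: "quat mat"
proof (induction k)
  case (Suc k)
  have "A ^\<^sub>m Suc (Suc k) = A * A ^\<^sub>m k * A" using Suc by simp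
  also have "\<dots> = A * A ^\<^sub>m Suc k" using Suc.prems by (simp add: mat_assoc)
  finally show ?case .
qed simp

lemma pow_mat_add: "A \<in> carrier_mat n n \<Longrightarrow> A ^\<^sub>m (k + l) = A ^\<^sub>m k * A ^\<^sub>m l" for A :: "quat mat"
  by (induction l) (simp_all add: mat_assoc)

lemma commute_pow_mat:
  fixes A X :: "quat mat"
  assumes "A \<in> carrier_mat n n" "X \<in> carrier_mat n n" "X * A = A * X"
  shows "X * A ^\<^sub>m k = A ^\<^sub>m k * X"
proof (induction k)
  case (Suc k)
  have "X * A ^\<^sub>m Suc k = X * A ^\<^sub>m k * A" using assms by (simp add: mat_assoc)
  also have "\<dots> = A ^\<^sub>m k * (X * A)" using assms Suc by (simp add: mat_assoc)
  also have "\<dots> = A ^\<^sub>m Suc k * X" using assms by (simp add: mat_assoc)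
  finally show ?case .
qed (use assms in simp)

lemma conj_transpose_dim [simp]:
  "dim_row (conj_transpose M) = dim_col M" "dim_col (conj_transpose M) = dim_row M"
  by (simp_all add: conj_transpose_def)

lemma conj_transpose_index [simp]:
  "i < dim_col M \<Longrightarrow> j < dim_row M \<Longrightarrow> conj_transpose M $$ (i, j) = qcnj (M $$ (j, i))"
  by (simp add: conj_transpose_def)

lemma conj_transpose_conj_transpose [simp]: "conj_transpose (conj_transpose M) = M"
  by (rule eq_matI) auto

lemma conj_transpose_mult:
  assumes "dim_col A = dim_row B"
  shows "conj_transpose (A * B) = conj_transpose B * conj_transpose A"
  by (rule eq_matI) (use assms in \<open>auto simp: index_mat_mult qcnj_sum qcnj_mult simp del: index_mult_mat(1)\<close>)

lemma conj_transpose_one [simp]: "conj_transpose (1\<^sub>m n) = 1\<^sub>m n"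
  by (rule eq_matI) auto

lemma conj_transpose_minus:
  assumes "dim_row A = dim_row B" "dim_col A = dim_col B"
  shows "conj_transpose (A - B) = conj_transpose A - conj_transpose B"
  by (rule eq_matI) (use assms in \<open>auto simp: qcnj_def minus_quat_def\<close>)

lemma conj_transpose_real_smult: "conj_transpose (of_real c \<cdot>\<^sub>m A) = of_real c \<cdot>\<^sub>m conj_transpose A"
  by (rule eq_matI) (auto simp: qcnj_mult of_real_central)

lemma q_hermitian_square: "q_hermitian H \<Longrightarrow> dim_row H = dim_col H"
  unfolding q_hermitian_def by (metis conj_transpose_dim(1))

lemma q_hermitian_pow:
  assumes "q_hermitian H" shows "q_hermitian (H ^\<^sub>m k)"
proof -
  have H: "H \<in> carrier_mat (dim_row H) (dim_row H)" using q_hermitian_square[OF assms] by auto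
  have sq: "dim_col H = dim_row H" using q_hermitian_square[OF assms] by simp
  have c: "conj_transpose H = H" using assms by (simp add: q_hermitian_def)
  show ?thesis
  proof (induction k)
    case (Suc k)
    have "conj_transpose (H ^\<^sub>m Suc k) = conj_transpose H * conj_transpose (H ^\<^sub>m k)"
      by (simp add: conj_transpose_mult sq)
    also have "\<dots> = H * H ^\<^sub>m k" using Suc c by (simp add: q_hermitian_def)
    finally show ?case using pow_mat_Suc_left[OF H] by (simp add: q_hermitian_def)
  qed (simp add: q_hermitian_def)
qed

lemma hermitian_on_q_hermitian:
  assumes "q_hermitian H" "S \<subseteq> {..<dim_row H}" shows "hermitian_on S H"
  unfolding hermitian_on_def
proof (intro ballI)
  fix p q assume "p \<in> S" "q \<in> S"
  then have "p < dim_row H" "q < dim_row H" using assms(2) by auto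
  then have "conj_transpose H $$ (q, p) = qcnj (H $$ (p, q))"
    using q_hermitian_square[OF assms(1)] by simp
  then show "H $$ (q, p) = qcnj (H $$ (p, q))" using assms(1) by (simp add: q_hermitian_def)
qed

text \<open>The trace itself is not invariant under \<open>A B \<mapsto> B A\<close> over the quaternions, but its real part is.\<close>

definition retrace :: "quat mat \<Rightarrow> real" where
  "retrace A = (\<Sum>i<dim_row A. qre (A $$ (i, i)))"

lemma retrace_one [simp]: "retrace (1\<^sub>m n) = real n"
  by (simp add: retrace_def)

lemma retrace_minus:
  assumes "dim_row A = dim_row B" "dim_col B = dim_row B"
  shows "retrace (A - B) = retrace A - retrace B"
  using assms by (simp add: retrace_def sum_subtractf)

lemma retrace_real_smult: "dim_row A = dim_col A \<Longrightarrow> retrace (of_real c \<cdot>\<^sub>m A) = c * retrace A"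
  by (simp add: retrace_def sum_distrib_left)

lemma retrace_mult_commute:
  assumes "dim_row A = dim_col B" "dim_col A = dim_row B"
  shows "retrace (A * B) = retrace (B * A)"
proof -
  have "retrace (A * B) = (\<Sum>i<dim_row A. \<Sum>k<dim_row B. qre (A $$ (i, k) * B $$ (k, i)))"
    using assms unfolding retrace_def by (simp add: index_mat_mult qre_sum del: index_mult_mat(1))
  also have "\<dots> = (\<Sum>k<dim_row B. \<Sum>i<dim_row A. qre (B $$ (k, i) * A $$ (i, k)))"
    by (subst sum.swap) (simp add: qre_mult_commute)
  also have "\<dots> = retrace (B * A)"
    using assms unfolding retrace_def by (simp add: index_mat_mult qre_sum del: index_mult_mat(1))
  finally show ?thesis .
qed

lemma retrace_gram: "retrace (conj_transpose Z * Z) = (\<Sum>i<dim_col Z. \<Sum>k<dim_row Z. qnorm2 (Z $$ (k, i)))"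
  unfolding retrace_def
  by (simp add: index_mat_mult qre_sum qcnj_times_self(1) del: index_mult_mat(1))

lemma qnorm2_nonneg: "qnorm2 x \<ge> 0"
  by (simp add: qnorm2_def)

lemma gram_eq_0:
  assumes "retrace (conj_transpose Z * Z) \<le> 0"
  shows "Z = 0\<^sub>m (dim_row Z) (dim_col Z)"
proof -
  have nonneg: "0 \<le> (\<Sum>k<dim_row Z. qnorm2 (Z $$ (k, i)))" for i by (intro sum_nonneg qnorm2_nonneg)
  then have "(\<Sum>i<dim_col Z. \<Sum>k<dim_row Z. qnorm2 (Z $$ (k, i))) = 0"
    using assms unfolding retrace_gram by (intro antisym sum_nonneg) (simp_all add: qnorm2_nonneg)
  then have "\<forall>i<dim_col Z. (\<Sum>k<dim_row Z. qnorm2 (Z $$ (k, i))) = 0"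
    using nonneg by (subst (asm) sum_nonneg_eq_0_iff) auto
  then have "\<forall>i<dim_col Z. \<forall>k<dim_row Z. qnorm2 (Z $$ (k, i)) = 0"
    by (auto simp: sum_nonneg_eq_0_iff qnorm2_nonneg)
  then show ?thesis using qnorm2_pos by (intro eq_matI) force+
qed

lemma gram_zero_cancel:
  assumes "conj_transpose Z * Z = 0\<^sub>m (dim_col Z) (dim_col Z)"
  shows "Z = 0\<^sub>m (dim_row Z) (dim_col Z)"
  by (rule gram_eq_0) (simp add: assms retrace_def)

text \<open>The Gram matrix of \<open>H Y\<close> is \<open>Y\<^sup>* H H Y\<close>, and a matrix with Gram matrix \<open>0\<close> is \<open>0\<close>.\<close>

lemma hermitian_mult_cancel:
  assumes "q_hermitian H" "dim_row Y = dim_row H" "H * (H * Y) = 0\<^sub>m (dim_row H) (dim_col Y)"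
  shows "H * Y = 0\<^sub>m (dim_row H) (dim_col Y)"
proof -
  have sq: "dim_col H = dim_row H" using q_hermitian_square[OF assms(1)] by simp
  have "conj_transpose (H * Y) * (H * Y) = conj_transpose Y * (H * (H * Y))"
    using assms(1,2) sq by (simp add: conj_transpose_mult mat_assoc q_hermitian_def)
  also have "\<dots> = 0\<^sub>m (dim_col Y) (dim_col Y)" unfolding assms(3) using assms(2) by simp
  finally show ?thesis using gram_zero_cancel[of "H * Y"] by simp
qed

section \<open>The Faddeev--LeVerrier recursion\<close>

text \<open>These are the coefficients of \<open>t\<^sup>n\<^sup>-\<^sup>s\<close> in the determinant and in the adjugate of \<open>t I + M\<close> for a
Hermitian matrix \<open>M\<close>.\<close>

definition minor_sum :: "nat \<Rightarrow> quat mat \<Rightarrow> nat \<Rightarrow> real" where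
  "minor_sum n M s = (\<Sum>\<alpha>\<in>index_sets s n. qre (row_minor M \<alpha>))"

definition adjugate :: "nat \<Rightarrow> quat mat \<Rightarrow> nat \<Rightarrow> quat mat" where
  "adjugate n M s = mat n n (\<lambda>(l, j).
     \<Sum>\<alpha>\<in>index_sets_at s n j. rdet \<alpha> j (replace_row M j (unit_vec n l)))"

lemma adjugate_dim [simp]: "dim_row (adjugate n M s) = n" "dim_col (adjugate n M s) = n"
  by (simp_all add: adjugate_def)

lemma finite_index_sets [simp]: "finite (index_sets s n)" "finite (index_sets_at s n j)"
  by (auto simp: index_sets_def index_sets_at_def)

lemma index_sets_atD:
  assumes "\<alpha> \<in> index_sets_at s n j" shows "finite \<alpha>" "j \<in> \<alpha>" "\<alpha> \<subseteq> {..<n}"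
  using assms by (auto simp: index_sets_def index_sets_at_def intro: finite_subset[of \<alpha> "{..<n}"])

lemma index_setsD: "\<alpha> \<in> index_sets s n \<Longrightarrow> finite \<alpha> \<and> \<alpha> \<subseteq> {..<n} \<and> card \<alpha> = s"
  by (auto simp: index_sets_def intro: finite_subset[of \<alpha> "{..<n}"])

text \<open>The row determinant is left linear in the replaced row, because the entry of this row is the leftmost
factor of each summand.\<close>

lemma sum_rdet_replace_row:
  assumes "M \<in> carrier_mat n n" "B \<in> carrier_mat m n" "i < m" "j < n"
  shows "(\<Sum>\<alpha>\<in>index_sets_at s n j. rdet \<alpha> j (replace_row M j (row B i))) = (B * adjugate n M s) $$ (i, j)"
proof -
  have "(\<Sum>\<alpha>\<in>index_sets_at s n j. rdet \<alpha> j (replace_row M j (row B i))) =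
    (\<Sum>\<alpha>\<in>index_sets_at s n j. \<Sum>l<n. B $$ (i, l) * rdet \<alpha> j (replace_row M j (unit_vec n l)))"
  proof (rule sum.cong[OF refl])
    fix \<alpha> assume "\<alpha> \<in> index_sets_at s n j"
    then show "rdet \<alpha> j (replace_row M j (row B i)) =
        (\<Sum>l<n. B $$ (i, l) * rdet \<alpha> j (replace_row M j (unit_vec n l)))"
      using rdet_replace_row_linear[of \<alpha> j n M "row B i"] index_sets_atD[of \<alpha> s n j] assms by simp
  qed
  also have "\<dots> = (\<Sum>l<n. B $$ (i, l) * adjugate n M s $$ (l, j))"
    using assms by (subst sum.swap) (simp add: adjugate_def sum_distrib_left)
  also have "\<dots> = (B * adjugate n M s) $$ (i, j)"
    using assms by (subst index_mat_mult) auto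
  finally show ?thesis .
qed

lemma sum_index_sets_at_Suc:
  assumes "j < n"
  shows "(\<Sum>\<alpha>\<in>index_sets_at (Suc s) n j. f (\<alpha> - {j})) = (\<Sum>\<beta> | \<beta> \<in> index_sets s n \<and> j \<notin> \<beta>. f \<beta>)"
  by (rule sum.reindex_bij_witness[where i = "insert j" and j = "\<lambda>\<alpha>. \<alpha> - {j}"])
     (use assms in \<open>auto simp: index_sets_def index_sets_at_def card_Diff_singleton
        card_insert_if finite_subset[of _ "{..<n}"]\<close>)

lemma adjugate_diagonal:
  assumes "M \<in> carrier_mat n n" "j < n"
  shows "adjugate n M (Suc s) $$ (j, j) = (\<Sum>\<beta> | \<beta> \<in> index_sets s n \<and> j \<notin> \<beta>. row_minor M \<beta>)"
proof -
  have "adjugate n M (Suc s) $$ (j, j) = (\<Sum>\<alpha>\<in>index_sets_at (Suc s) n j. row_minor M (\<alpha> - {j}))"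
    using assms rdet_replace_unit_self[OF index_sets_atD assms(1)]
    by (simp add: adjugate_def)
  also have "\<dots> = (\<Sum>\<beta> | \<beta> \<in> index_sets s n \<and> j \<notin> \<beta>. row_minor M \<beta>)"
    by (rule sum_index_sets_at_Suc[OF assms(2)])
  finally show ?thesis .
qed

lemma adjugate_off_diagonal:
  assumes "M \<in> carrier_mat n n" "j < n" "l < n" "l \<noteq> j"
  shows "adjugate n M (Suc s) $$ (l, j) =
    - (\<Sum>\<alpha> | \<alpha> \<in> index_sets_at s n j \<and> l \<notin> \<alpha>. rdet \<alpha> j (replace_row M j (row M l)))"
proof -
  let ?f = "\<lambda>\<alpha>. rdet \<alpha> j (replace_row M j (unit_vec n l))"
  have "adjugate n M (Suc s) $$ (l, j) = (\<Sum>\<alpha>\<in>index_sets_at (Suc s) n j. ?f \<alpha>)"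
    using assms by (simp add: adjugate_def)
  also have "\<dots> = (\<Sum>\<alpha> | \<alpha> \<in> index_sets_at (Suc s) n j \<and> l \<in> \<alpha>. ?f \<alpha>)"
  proof (rule sum.mono_neutral_right)
    show "\<forall>\<alpha>\<in>index_sets_at (Suc s) n j - {\<alpha>. \<alpha> \<in> index_sets_at (Suc s) n j \<and> l \<in> \<alpha>}. ?f \<alpha> = 0"
      using rdet_replace_unit_outside[OF index_sets_atD assms(1) _ assms(3)] by blast
  qed auto
  also have "\<dots> = (\<Sum>\<alpha> | \<alpha> \<in> index_sets_at s n j \<and> l \<notin> \<alpha>. ?f (insert l \<alpha>))"
    by (rule sum.reindex_bij_witness[where j = "\<lambda>\<alpha>. \<alpha> - {l}" and i = "insert l"])
       (use assms in \<open>auto simp: index_sets_def index_sets_at_def card_Diff_singleton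
          card_insert_if finite_subset[of _ "{..<n}"] insert_absorb\<close>)
  also have "\<dots> = (\<Sum>\<alpha> | \<alpha> \<in> index_sets_at s n j \<and> l \<notin> \<alpha>. - rdet \<alpha> j (replace_row M j (row M l)))"
    using rdet_replace_unit_insert[OF index_sets_atD assms(1) _ assms(3)]
    by (intro sum.cong) auto
  finally show ?thesis by (simp add: sum_negf)
qed

text \<open>An entry of \<open>M G\<^sub>s\<close> is a sum of row determinants in which row \<open>j\<close> is overwritten by row \<open>l\<close>. On the
diagonal these are the minors that contain \<open>j\<close>, and \<open>G\<^sub>s\<^sub>+\<^sub>1\<close> contributes those that avoid \<open>j\<close>. Off the
diagonal the index sets containing \<open>l\<close> contribute \<open>0\<close> and the others cancel against \<open>G\<^sub>s\<^sub>+\<^sub>1\<close>.\<close>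

theorem adjugate_recursion:
  assumes M: "M \<in> carrier_mat n n" "q_hermitian M"
  shows "adjugate n M (Suc s) = of_real (minor_sum n M s) \<cdot>\<^sub>m 1\<^sub>m n - M * adjugate n M s"
proof (rule eq_matI)
  fix l j assume "l < dim_row (of_real (minor_sum n M s) \<cdot>\<^sub>m 1\<^sub>m n - M * adjugate n M s)"
    "j < dim_col (of_real (minor_sum n M s) \<cdot>\<^sub>m 1\<^sub>m n - M * adjugate n M s)"
  then have lj: "l < n" "j < n" using M(1) by auto
  let ?f = "\<lambda>\<alpha>. rdet \<alpha> j (replace_row M j (row M l))"
  have prod: "(M * adjugate n M s) $$ (l, j) = (\<Sum>\<alpha>\<in>index_sets_at s n j. ?f \<alpha>)"
    using sum_rdet_replace_row[OF M(1) M(1) lj] by simp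
  have herm: "hermitian_on \<alpha> M" if "\<alpha> \<subseteq> {..<n}" for \<alpha>
    using hermitian_on_q_hermitian[OF M(2)] that M(1) by auto
  have sum: "of_real (minor_sum n M s) = (\<Sum>\<alpha>\<in>index_sets s n. row_minor M \<alpha>)"
    unfolding minor_sum_def of_real_sum
    using index_setsD herm row_minor_real[symmetric] by (intro sum.cong) auto
  have "adjugate n M (Suc s) $$ (l, j) + (M * adjugate n M s) $$ (l, j) =
      (if l = j then of_real (minor_sum n M s) else 0)"
  proof (cases "l = j")
    case True
    have "(\<Sum>\<alpha>\<in>index_sets_at s n j. ?f \<alpha>) = (\<Sum>\<alpha> | \<alpha> \<in> index_sets s n \<and> j \<in> \<alpha>. row_minor M \<alpha>)"
      using rdet_hermitian[OF index_sets_atD(1) herm[OF index_sets_atD(3)] index_sets_atD(2)] True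
      by (intro sum.cong) (auto simp: index_sets_at_def replace_row_self)
    moreover have "(\<Sum>\<alpha>\<in>index_sets s n. row_minor M \<alpha>) =
        (\<Sum>\<alpha> | \<alpha> \<in> index_sets s n \<and> j \<in> \<alpha>. row_minor M \<alpha>) + (\<Sum>\<alpha> | \<alpha> \<in> index_sets s n \<and> j \<notin> \<alpha>. row_minor M \<alpha>)"
      by (subst sum.union_disjoint[symmetric]) (auto intro!: sum.cong)
    ultimately show ?thesis
      using True adjugate_diagonal[OF M(1) lj(2), of s] prod sum by simp
  next
    case False
    have "(\<Sum>\<alpha>\<in>index_sets_at s n j. ?f \<alpha>) = (\<Sum>\<alpha> | \<alpha> \<in> index_sets_at s n j \<and> l \<notin> \<alpha>. ?f \<alpha>)"
      using rdet_replace_by_other_row[OF index_sets_atD(1,2) _ False index_sets_atD(3) M(1)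
          herm[OF index_sets_atD(3)]]
      by (intro sum.mono_neutral_right) auto
    then show ?thesis using False adjugate_off_diagonal[OF M(1) lj(2,1) False, of s] prod by simp
  qed
  then show "adjugate n M (Suc s) $$ (l, j) =
      (of_real (minor_sum n M s) \<cdot>\<^sub>m 1\<^sub>m n - M * adjugate n M s) $$ (l, j)"
    using lj M(1) by (auto simp: eq_diff_eq simp del: index_mult_mat(1))
qed (use M in auto)

text \<open>A minor of size \<open>s\<close> appears in the diagonal entries of the \<open>n - s\<close> indices that it avoids.\<close>

lemma retrace_adjugate:
  assumes "M \<in> carrier_mat n n"
  shows "retrace (adjugate n M (Suc s)) = (real n - real s) * minor_sum n M s"
proof -
  have "retrace (adjugate n M (Suc s)) = (\<Sum>j<n. \<Sum>\<beta> | \<beta> \<in> index_sets s n \<and> j \<notin> \<beta>. qre (row_minor M \<beta>))"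
    using adjugate_diagonal[OF assms] by (simp add: retrace_def qre_sum)
  also have "\<dots> = (\<Sum>\<beta>\<in>index_sets s n. \<Sum>j | j \<in> {..<n} \<and> j \<notin> \<beta>. qre (row_minor M \<beta>))"
    by (subst sum.swap_restrict[symmetric]) auto
  also have "\<dots> = (\<Sum>\<beta>\<in>index_sets s n. (real n - real s) * qre (row_minor M \<beta>))"
  proof (rule sum.cong[OF refl])
    fix \<beta> assume "\<beta> \<in> index_sets s n"
    then have b: "finite \<beta>" "\<beta> \<subseteq> {..<n}" "card \<beta> = s" using index_setsD by auto
    have "{j. j \<in> {..<n} \<and> j \<notin> \<beta>} = {..<n} - \<beta>" by auto
    moreover have "s \<le> n" using b card_mono[of "{..<n}" \<beta>] by simp
    ultimately show "(\<Sum>j | j \<in> {..<n} \<and> j \<notin> \<beta>. qre (row_minor M \<beta>)) = (real n - real s) * qre (row_minor M \<beta>)"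
      using b by (simp add: card_Diff_subset of_nat_diff)
  qed
  finally show ?thesis by (simp add: minor_sum_def sum_distrib_left)
qed

lemma index_sets_0 [simp]: "index_sets 0 n = {{}}"
  by (auto simp: index_sets_def dest: finite_subset)

lemma index_sets_at_0 [simp]: "index_sets_at 0 n j = {}"
  by (auto simp: index_sets_at_def)

lemma index_sets_gt: "s > n \<Longrightarrow> index_sets s n = {}"
proof -
  assume "s > n"
  moreover have "card \<alpha> \<le> n" if "\<alpha> \<subseteq> {..<n}" for \<alpha> using card_mono[OF _ that] by simp
  ultimately show ?thesis unfolding index_sets_def using leD by blast
qed

lemma minor_sum_0: "minor_sum n M 0 = 1"
  by (simp add: minor_sum_def)

lemma minor_sum_gt: "s > n \<Longrightarrow> minor_sum n M s = 0"
  by (simp add: minor_sum_def index_sets_gt)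

lemma adjugate_0: "adjugate n M 0 = 0\<^sub>m n n"
  by (rule eq_matI) (auto simp: adjugate_def)

lemma adjugate_gt: "s > n \<Longrightarrow> adjugate n M s = 0\<^sub>m n n"
  by (rule eq_matI) (auto simp: adjugate_def index_sets_at_def index_sets_gt)

lemma mult_minus_mat:
  fixes A B C :: "quat mat"
  assumes "dim_col A = dim_row B" "dim_row B = dim_row C" "dim_col B = dim_col C"
  shows "A * (B - C) = A * B - A * C"
  by (rule mult_minus_distrib_mat[of A "dim_row A" "dim_row B" B "dim_col B" C]) (use assms in auto)

lemma minus_mult_mat:
  fixes A B C :: "quat mat"
  assumes "dim_col A = dim_row C" "dim_row B = dim_row A" "dim_col B = dim_col A"
  shows "(A - B) * C = A * C - B * C"
  by (rule minus_mult_distrib_mat[of A "dim_row A" "dim_row C" B C "dim_col C"]) (use assms in auto)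

text \<open>By the recursion \<open>G\<^sub>s\<close> is a polynomial in \<open>M\<close> with real coefficients.\<close>

lemma adjugate_commute:
  assumes M: "M \<in> carrier_mat n n" "q_hermitian M" and X: "X \<in> carrier_mat n n" "X * M = M * X"
  shows "X * adjugate n M s = adjugate n M s * X"
proof (induction s)
  case 0
  then show ?case using X by (simp add: adjugate_0)
next
  case (Suc s)
  have "X * (M * adjugate n M s) = M * adjugate n M s * X"
  proof -
    have "X * (M * adjugate n M s) = M * (X * adjugate n M s)"
      using M X by (simp add: mat_assoc[symmetric])
    also have "\<dots> = M * adjugate n M s * X" unfolding Suc.IH using M X by (simp add: mat_assoc)
    finally show ?thesis .
  qed
  then show ?case
    unfolding adjugate_recursion[OF M] using M X
    by (simp add: mult_minus_mat minus_mult_mat mult_real_smult real_smult_mult)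
qed

lemma adjugate_hermitian:
  assumes M: "M \<in> carrier_mat n n" "q_hermitian M"
  shows "q_hermitian (adjugate n M s)"
proof (induction s)
  case 0
  show ?case unfolding adjugate_0 q_hermitian_def by (rule eq_matI) auto
next
  case (Suc s)
  have "conj_transpose (M * adjugate n M s) = adjugate n M s * M"
    using M Suc by (simp add: conj_transpose_mult q_hermitian_def)
  also have "\<dots> = M * adjugate n M s" using adjugate_commute[OF M M(1)] by simp
  finally show ?case
    unfolding adjugate_recursion[OF M] q_hermitian_def using M
    by (simp add: conj_transpose_minus conj_transpose_real_smult)
qed

text \<open>Beyond the last nonzero coefficient \<open>d\<^sub>q\<close> the recursion only multiplies by \<open>- M\<close>, and it ends in \<open>0\<close>
after \<open>G\<^sub>n\<close>. As \<open>M\<close> is Hermitian, its powers can be cancelled down to one factor, so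
\<open>0 = M G\<^sub>q\<^sub>+\<^sub>1 = d\<^sub>q M - M M G\<^sub>q\<close>. Comparing the traces of \<open>G\<^sub>q\<^sub>+\<^sub>1 = d\<^sub>q I - M G\<^sub>q\<close> determines
the trace of \<open>M G\<^sub>q\<close>.\<close>

theorem hermitian_group_inverse:
  assumes M: "M \<in> carrier_mat n n" "q_hermitian M"
  obtains q T where "minor_sum n M q \<noteq> 0" "T = of_real (1 / minor_sum n M q) \<cdot>\<^sub>m adjugate n M q"
    "M * (M * T) = M" "retrace (M * T) = real q"
proof -
  let ?d = "minor_sum n M" and ?G = "adjugate n M"
  define q where "q = Max {s. ?d s \<noteq> 0}"
  have "{s. ?d s \<noteq> 0} \<subseteq> {..n}"
  proof
    fix s assume "s \<in> {s. ?d s \<noteq> 0}"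
    then show "s \<in> {..n}" using minor_sum_gt[of n s M] by (cases "s \<le> n") auto
  qed
  then have fin: "finite {s. ?d s \<noteq> 0}" by (rule finite_subset) simp
  have "0 \<in> {s. ?d s \<noteq> 0}" by (simp add: minor_sum_0)
  then have "q \<in> {s. ?d s \<noteq> 0}" unfolding q_def using fin by (intro Max_in) auto
  then have dq: "?d q \<noteq> 0" by simp
  have above: "?d s = 0" if "s > q" for s
  proof (rule ccontr)
    assume "?d s \<noteq> 0"
    then have "s \<le> q" unfolding q_def using fin by (intro Max_ge) auto
    then show False using that by simp
  qed
  have "q \<le> n" using dq minor_sum_gt[of n q M] by (cases "q \<le> n") auto
  \<comment> \<open>descending from \<open>G\<^sub>n\<^sub>+\<^sub>1 = 0\<close>: if \<open>M G\<^sub>s\<^sub>+\<^sub>2 = - M M G\<^sub>s\<^sub>+\<^sub>1\<close> vanishes, so does \<open>M G\<^sub>s\<^sub>+\<^sub>1\<close>\<close>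
  then have "M * ?G (Suc q) = 0\<^sub>m n n"
  proof (induction rule: inc_induct)
    case base
    then show ?case using M by (simp add: adjugate_gt)
  next
    case (step s)
    have "?G (Suc (Suc s)) = - (M * ?G (Suc s))"
      unfolding adjugate_recursion[OF M, of "Suc s"] using above[of "Suc s"] step.hyps M
      by (intro eq_matI) auto
    then have "M * (M * ?G (Suc s)) = - (M * ?G (Suc (Suc s)))" using M by simp
    also have "\<dots> = 0\<^sub>m n n" unfolding step.IH by (rule eq_matI) auto
    finally show ?case using hermitian_mult_cancel[OF M(2), of "?G (Suc s)"] M(1) by simp
  qed
  then have eq: "of_real (?d q) \<cdot>\<^sub>m M - M * (M * ?G q) = 0\<^sub>m n n"
    unfolding adjugate_recursion[OF M] using M by (simp add: mult_minus_mat mult_real_smult)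
  define T where "T = of_real (1 / ?d q) \<cdot>\<^sub>m ?G q"
  have MMG: "M * (M * ?G q) = of_real (?d q) \<cdot>\<^sub>m M"
  proof (rule eq_matI)
    fix i j assume "i < dim_row (of_real (?d q) \<cdot>\<^sub>m M)" "j < dim_col (of_real (?d q) \<cdot>\<^sub>m M)"
    then have ij: "i < n" "j < n" using M by auto
    then have "(of_real (?d q) \<cdot>\<^sub>m M - M * (M * ?G q)) $$ (i, j) = 0" unfolding eq by simp
    then show "(M * (M * ?G q)) $$ (i, j) = (of_real (?d q) \<cdot>\<^sub>m M) $$ (i, j)"
      using ij M by (simp del: index_mult_mat(1))
  qed (use M in auto)
  have "M * (M * T) = of_real (1 / ?d q) \<cdot>\<^sub>m (M * (M * ?G q))"
    unfolding T_def using M by (simp add: mult_real_smult del: of_real_divide)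
  also have "\<dots> = M" unfolding MMG using dq
    by (intro eq_matI) (auto simp: mult.assoc[symmetric] of_real_mult[symmetric] simp del: of_real_mult of_real_divide)
  finally have MMT: "M * (M * T) = M" .
  have "(real n - real q) * ?d q = ?d q * real n - retrace (M * ?G q)"
    using retrace_adjugate[OF M(1), of q] M
    unfolding adjugate_recursion[OF M] by (simp add: retrace_minus retrace_real_smult)
  then have "retrace (M * ?G q) = real q * ?d q" by (simp add: algebra_simps)
  then have "retrace (M * T) = real q"
    unfolding T_def using M dq by (simp add: mult_real_smult retrace_real_smult del: of_real_divide)
  then show thesis using that dq MMT T_def by blast
qed

section \<open>Column spaces and rank\<close>

text \<open>The columns of \<open>B\<close> are right linearly independent; in this form the notion fits the associative law for
products of matrices.\<close>

definition cancellable :: "quat mat \<Rightarrow> bool" where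
  "cancellable B \<longleftrightarrow> (\<forall>Y. dim_row Y = dim_col B \<longrightarrow>
     B * Y = 0\<^sub>m (dim_row B) (dim_col Y) \<longrightarrow> Y = 0\<^sub>m (dim_col B) (dim_col Y))"

lemma cancellableD:
  "cancellable B \<Longrightarrow> dim_row Y = dim_col B \<Longrightarrow> B * Y = 0\<^sub>m (dim_row B) (dim_col Y) \<Longrightarrow>
     Y = 0\<^sub>m (dim_col B) (dim_col Y)"
  by (simp add: cancellable_def)

lemma minus_mat_eq_0:
  fixes A B :: "quat mat"
  assumes "A - B = 0\<^sub>m nr nc" "dim_row A = dim_row B" "dim_col A = dim_col B"
  shows "A = B"
proof (rule eq_matI)
  fix i j assume ij: "i < dim_row B" "j < dim_col B"
  have "dim_row B = nr" "dim_col B = nc"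
    using arg_cong[OF assms(1), of dim_row] arg_cong[OF assms(1), of dim_col] by simp_all
  then have "(A - B) $$ (i, j) = 0" using assms(1) ij by simp
  then show "A $$ (i, j) = B $$ (i, j)" using ij by simp
qed (use assms in auto)

lemma minus_mat_self: "A - A = 0\<^sub>m (dim_row A) (dim_col A)" for A :: "quat mat"
  by (rule eq_matI) auto

text \<open>The Gram matrix \<open>H = B\<^sup>* B\<close> is Hermitian and cancellable, so its group inverse \<open>T\<close> is a two-sided
inverse, and \<open>L = T B\<^sup>*\<close>. The matrix \<open>F = I - B L\<close> is a Hermitian projection with
\<open>Re tr F = Re tr (F\<^sup>* F) = m - p\<close>. This is nonnegative, and \<open>F = 0\<close> if it vanishes. Thus there are at most
\<open>m\<close> independent columns of height \<open>m\<close>, and an independent family of \<open>m\<close> columns spans.\<close>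

lemma cancellable_left_inverse:
  assumes B: "B \<in> carrier_mat m p" "cancellable B"
  obtains L where "L \<in> carrier_mat p m" "L * B = 1\<^sub>m p" "p \<le> m" "p = m \<Longrightarrow> B * L = 1\<^sub>m m"
proof -
  let ?B' = "conj_transpose B"
  define H where "H = ?B' * B"
  have H: "H \<in> carrier_mat p p" "q_hermitian H"
    unfolding H_def using B by (auto simp: q_hermitian_def conj_transpose_mult)
  obtain q T where T: "T = of_real (1 / minor_sum p H q) \<cdot>\<^sub>m adjugate p H q" "H * (H * T) = H"
    using hermitian_group_inverse[OF H] by metis
  have dT: "T \<in> carrier_mat p p" unfolding T(1) by auto
  have comm: "H * T = T * H"
    unfolding T(1) using adjugate_commute[OF H H(1) refl, of q] H(1)
    by (simp add: mult_real_smult real_smult_mult del: of_real_divide)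
  have Therm: "conj_transpose T = T"
    unfolding T(1) using adjugate_hermitian[OF H, of q]
    by (simp add: conj_transpose_real_smult q_hermitian_def del: of_real_divide)
  define Z where "Z = H * T - 1\<^sub>m p"
  have Z: "dim_row Z = p" "dim_col Z = p" by (simp_all add: Z_def)
  have "H * Z = 0\<^sub>m p p"
    unfolding Z_def using T(2) H(1) dT by (simp add: mult_minus_mat minus_mat_self)
  moreover have "conj_transpose (B * Z) * (B * Z) = conj_transpose Z * (H * Z)"
    unfolding H_def using B Z by (simp add: conj_transpose_mult mat_assoc)
  ultimately have "conj_transpose (B * Z) * (B * Z) = 0\<^sub>m p p" using Z by simp
  then have "B * Z = 0\<^sub>m m p" using gram_zero_cancel[of "B * Z"] B Z by simp
  then have "Z = 0\<^sub>m p p" using cancellableD[OF B(2), of Z] B Z by simp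
  then have HT: "H * T = 1\<^sub>m p"
    unfolding Z_def by (rule minus_mat_eq_0) (use H(1) dT in auto)
  define L where "L = T * ?B'"
  have L: "L \<in> carrier_mat p m" unfolding L_def using dT B by auto
  have LB: "L * B = 1\<^sub>m p"
    unfolding L_def using HT[unfolded comm] dT B by (simp add: mat_assoc H_def)
  define F where "F = 1\<^sub>m m - B * L"
  have F: "dim_row F = m" "dim_col F = m" using B L by (auto simp: F_def)
  have BL_herm: "conj_transpose (B * L) = B * L"
    unfolding L_def using B dT Therm by (simp add: conj_transpose_mult mat_assoc)
  have BLBL: "B * L * (B * L) = B * L"
  proof -
    have "B * L * (B * L) = B * (L * B * L)" using B L by (simp add: mat_assoc)
    then show ?thesis unfolding LB using L by simp
  qed
  have Fherm: "conj_transpose F = F"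
    unfolding F_def using B L BL_herm by (simp add: conj_transpose_minus)
  have FF: "F * F = F"
  proof -
    have "F * F = F - F * (B * L)" unfolding F_def using B L
      by (subst mult_minus_mat) auto
    also have "F * (B * L) = 0\<^sub>m m m" unfolding F_def using B L BLBL
      by (subst minus_mult_mat) (auto simp: minus_mat_self)
    finally show ?thesis using F by (auto intro!: eq_matI)
  qed
  have tr: "retrace (conj_transpose F * F) = real m - real p"
  proof -
    have "retrace (B * L) = real p" using retrace_mult_commute[of B L] B L LB by simp
    then show ?thesis unfolding Fherm FF unfolding F_def using B L by (simp add: retrace_minus)
  qed
  have "retrace (conj_transpose F * F) \<ge> 0" unfolding retrace_gram by (intro sum_nonneg qnorm2_nonneg)
  then have "p \<le> m" unfolding tr by simp
  moreover have "B * L = 1\<^sub>m m" if "p = m"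
  proof -
    have "F = 0\<^sub>m m m" using gram_eq_0[of F] tr that F by simp
    then have "1\<^sub>m m = B * L" unfolding F_def by (rule minus_mat_eq_0) (use B L in auto)
    then show ?thesis by simp
  qed
  ultimately show thesis using that L LB by blast
qed

text \<open>Coefficient vectors are taken as matrices with one column, again for the sake of associativity.\<close>

definition column_space :: "quat mat \<Rightarrow> quat vec set" where
  "column_space M = {col (M * Y) 0 | Y. Y \<in> carrier_mat (dim_col M) 1}"

lemma factor_through_columns:
  assumes "dim_row N = dim_row M" "\<And>j. j < dim_col N \<Longrightarrow> col N j \<in> column_space M"
  obtains Z where "Z \<in> carrier_mat (dim_col M) (dim_col N)" "N = M * Z"
proof -
  have "\<exists>y\<in>carrier_mat (dim_col M) 1. col N j = col (M * y) 0" if "j < dim_col N" for j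
    using assms(2)[OF that] unfolding column_space_def by auto
  then obtain y where y: "\<And>j. j < dim_col N \<Longrightarrow> y j \<in> carrier_mat (dim_col M) 1"
    "\<And>j. j < dim_col N \<Longrightarrow> col N j = col (M * y j) 0"
    by metis
  define Z where "Z = mat (dim_col M) (dim_col N) (\<lambda>(i, j). y j $$ (i, 0))"
  have "N = M * Z"
  proof (rule eq_matI)
    fix i j assume "i < dim_row (M * Z)" "j < dim_col (M * Z)"
    then have ij: "i < dim_row M" "j < dim_col N" by (auto simp: Z_def)
    have "N $$ (i, j) = col N j $ i" using ij assms(1) by simp
    also have "\<dots> = (M * y j) $$ (i, 0)" unfolding y(2)[OF ij(2)] using ij y(1)[OF ij(2)]
      by (simp del: index_mult_mat(1))
    also have "\<dots> = (M * Z) $$ (i, j)"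
      using ij y(1)[OF ij(2)] by (simp add: index_mat_mult Z_def del: index_mult_mat(1))
    finally show "N $$ (i, j) = (M * Z) $$ (i, j)" .
  qed (use assms(1) in \<open>auto simp: Z_def\<close>)
  moreover have "Z \<in> carrier_mat (dim_col M) (dim_col N)" by (simp add: Z_def)
  ultimately show thesis using that by blast
qed

lemma col_in_column_space:
  assumes "j < dim_col N" shows "col N j \<in> column_space N"
proof -
  let ?e = "mat (dim_col N) 1 (\<lambda>(k, _). if k = j then 1 else 0 :: quat)"
  have "col (N * ?e) 0 = col N j"
  proof (rule eq_vecI)
    fix i assume "i < dim_vec (col N j)"
    then have i: "i < dim_row N" by simp
    have "(N * ?e) $$ (i, 0) = (\<Sum>k<dim_col N. if k = j then N $$ (i, k) else 0)"
      using i by (subst index_mat_mult) (auto simp: if_distrib[of "(*) _"] cong: if_cong)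
    then show "col (N * ?e) 0 $ i = col N j $ i" using i assms by (simp del: index_mult_mat(1))
  qed simp
  then show ?thesis unfolding column_space_def by (force intro!: exI[of _ ?e])
qed

lemma column_space_subset_iff:
  assumes "dim_row N = dim_row M"
  shows "column_space N \<subseteq> column_space M \<longleftrightarrow> (\<exists>Z\<in>carrier_mat (dim_col M) (dim_col N). N = M * Z)"
proof
  assume "column_space N \<subseteq> column_space M"
  then have "col N j \<in> column_space M" if "j < dim_col N" for j
    using col_in_column_space[OF that] by blast
  then show "\<exists>Z\<in>carrier_mat (dim_col M) (dim_col N). N = M * Z"
    using factor_through_columns[OF assms] by metis
next
  assume "\<exists>Z\<in>carrier_mat (dim_col M) (dim_col N). N = M * Z"
  then obtain Z where Z: "Z \<in> carrier_mat (dim_col M) (dim_col N)" "N = M * Z" by blast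
  show "column_space N \<subseteq> column_space M"
  proof
    fix v assume "v \<in> column_space N"
    then obtain Y where Y: "Y \<in> carrier_mat (dim_col N) 1" "v = col (N * Y) 0"
      by (auto simp: column_space_def)
    have "N * Y = M * (Z * Y)"
      unfolding Z(2) by (rule mat_assoc) (use Z(1) Y(1) in auto)
    then have "v = col (M * (Z * Y)) 0" using Y(2) by simp
    moreover have "Z * Y \<in> carrier_mat (dim_col M) 1" by (rule mult_carrier_mat[OF Z(1) Y(1)])
    ultimately show "v \<in> column_space M" unfolding column_space_def by blast
  qed
qed

lemma right_lincomb_index: "p < m \<Longrightarrow> right_lincomb m c B $ p = (\<Sum>v\<in>B. v $ p * c v)"
  and right_lincomb_dim [simp]: "dim_vec (right_lincomb m c B) = m"
  by (simp_all add: right_lincomb_def)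

lemma sum_over_columns:
  fixes M :: "quat mat"
  assumes "i < dim_row M"
  shows "(\<Sum>k<dim_col M. M $$ (i, k) * y k) =
    (\<Sum>v\<in>set (cols M). v $ i * (\<Sum>k | k < dim_col M \<and> col M k = v. y k))"
proof -
  have "set (cols M) = col M ` {..<dim_col M}" by (auto simp: cols_def)
  then have "(\<Sum>k<dim_col M. M $$ (i, k) * y k) =
      (\<Sum>v\<in>set (cols M). \<Sum>k | k \<in> {..<dim_col M} \<and> col M k = v. M $$ (i, k) * y k)"
    using sum.image_gen[of "{..<dim_col M}" "\<lambda>k. M $$ (i, k) * y k" "col M"] by simp
  also have "\<dots> = (\<Sum>v\<in>set (cols M). v $ i * (\<Sum>k | k < dim_col M \<and> col M k = v. y k))"
  proof (rule sum.cong[OF refl])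
    fix v
    show "(\<Sum>k | k \<in> {..<dim_col M} \<and> col M k = v. M $$ (i, k) * y k) =
        v $ i * (\<Sum>k | k < dim_col M \<and> col M k = v. y k)"
      unfolding sum_distrib_left using assms by (intro sum.cong) auto
  qed
  finally show ?thesis .
qed

text \<open>Linear combinations of the set of columns use each vector once, whereas \<open>M\<close> may repeat columns. One
direction selects an index for each vector, the other one adds up the coefficients of equal columns.\<close>

lemma right_span_cols: "right_span (dim_row M) (set (cols M)) = column_space M"
proof (intro equalityI subsetI)
  fix u assume "u \<in> right_span (dim_row M) (set (cols M))"
  then obtain c B where B: "B \<subseteq> set (cols M)" "u = right_lincomb (dim_row M) c B"
    by (auto simp: right_span_def)
  have "\<exists>k<dim_col M. col M k = v" if "v \<in> B" for v
  proof -
    have "v \<in> col M ` {0..<dim_col M}" using that B(1) by (auto simp: cols_def)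
    then show ?thesis by auto
  qed
  then obtain f where f: "\<And>v. v \<in> B \<Longrightarrow> f v < dim_col M \<and> col M (f v) = v" by metis
  then have inj: "inj_on f B" by (metis inj_onI)
  define Y where "Y = mat (dim_col M) 1 (\<lambda>(k, _). if k \<in> f ` B then c (col M k) else 0)"
  have "u = col (M * Y) 0"
  proof (rule eq_vecI)
    fix i assume "i < dim_vec (col (M * Y) 0)"
    then have i: "i < dim_row M" by simp
    have "(M * Y) $$ (i, 0) = (\<Sum>k<dim_col M. if k \<in> f ` B then M $$ (i, k) * c (col M k) else 0)"
      using i by (subst index_mat_mult) (auto simp: Y_def intro!: sum.cong)
    also have "\<dots> = (\<Sum>k\<in>{..<dim_col M} \<inter> f ` B. M $$ (i, k) * c (col M k))"
      by (simp add: sum.inter_restrict)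
    also have "{..<dim_col M} \<inter> f ` B = f ` B" using f by auto
    also have "(\<Sum>k\<in>f ` B. M $$ (i, k) * c (col M k)) = (\<Sum>v\<in>B. v $ i * c v)"
      unfolding sum.reindex[OF inj] o_def using f i by (intro sum.cong) (metis index_col)+
    finally show "u $ i = col (M * Y) 0 $ i"
      using i by (simp add: B(2) right_lincomb_index Y_def del: index_mult_mat(1))
  qed (simp add: B(2))
  then show "u \<in> column_space M" unfolding column_space_def Y_def by auto
next
  fix u assume "u \<in> column_space M"
  then obtain Y where Y: "Y \<in> carrier_mat (dim_col M) 1" "u = col (M * Y) 0"
    by (auto simp: column_space_def)
  let ?c = "\<lambda>v. \<Sum>k | k < dim_col M \<and> col M k = v. Y $$ (k, 0)"
  have "u = right_lincomb (dim_row M) ?c (set (cols M))"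
  proof (rule eq_vecI)
    fix i assume "i < dim_vec (right_lincomb (dim_row M) ?c (set (cols M)))"
    then have i: "i < dim_row M" by simp
    have "u $ i = (\<Sum>k<dim_col M. M $$ (i, k) * Y $$ (k, 0))"
      using i Y by (simp add: index_mat_mult del: index_mult_mat(1))
    then show "u $ i = right_lincomb (dim_row M) ?c (set (cols M)) $ i"
      using i by (simp add: right_lincomb_index sum_over_columns)
  qed (simp add: Y(2))
  then show "u \<in> right_span (dim_row M) (set (cols M))" unfolding right_span_def by blast
qed

lemma right_span_list:
  assumes "set bs \<subseteq> carrier_vec m"
  shows "right_span m (set bs) = column_space (mat_of_cols m bs)"
  using right_span_cols[of "mat_of_cols m bs"] assms by simp

lemma cancellable_mat_of_cols:
  assumes "distinct bs" "set bs \<subseteq> carrier_vec m" "right_indep m (set bs)"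
  shows "cancellable (mat_of_cols m bs)"
  unfolding cancellable_def
proof (intro allI impI)
  fix Y :: "quat mat"
  let ?B = "mat_of_cols m bs"
  assume Y: "dim_row Y = dim_col ?B" "?B * Y = 0\<^sub>m (dim_row ?B) (dim_col Y)"
  show "Y = 0\<^sub>m (dim_col ?B) (dim_col Y)"
  proof (rule eq_matI)
    fix k j assume "k < dim_row (0\<^sub>m (dim_col ?B) (dim_col Y) :: quat mat)"
      "j < dim_col (0\<^sub>m (dim_col ?B) (dim_col Y) :: quat mat)"
    then have kj: "k < length bs" "j < dim_col Y" by auto
    have bij: "bij_betw (nth bs) {..<length bs} (set bs)" by (rule bij_betw_nth) (use assms in auto)
    define c where "c = (\<lambda>v. Y $$ (inv_into {..<length bs} (nth bs) v, j))"
    have c: "c (bs ! a) = Y $$ (a, j)" if "a < length bs" for a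
      unfolding c_def using bij_betw_inv_into_left[OF bij, of a] that by simp
    have "right_lincomb m c (set bs) = 0\<^sub>v m"
    proof (rule eq_vecI)
      fix i assume "i < dim_vec (0\<^sub>v m :: quat vec)"
      then have i: "i < m" by simp
      have "right_lincomb m c (set bs) $ i = (\<Sum>a<length bs. bs ! a $ i * c (bs ! a))"
        using i by (simp add: right_lincomb_index sum.reindex_bij_betw[OF bij, symmetric])
      also have "\<dots> = (?B * Y) $$ (i, j)"
        using i kj Y(1) by (simp add: index_mat_mult mat_of_cols_index c del: index_mult_mat(1))
      also have "\<dots> = 0" unfolding Y(2) using i kj by simp
      finally show "right_lincomb m c (set bs) $ i = 0\<^sub>v m $ i" using i by simp
    qed simp
    then have "\<forall>v\<in>set bs. c v = 0" using assms(3) unfolding right_indep_def by blast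
    then have "c (bs ! k) = 0" using kj by simp
    then show "Y $$ (k, j) = 0\<^sub>m (dim_col ?B) (dim_col Y) $$ (k, j)" using c kj by simp
  qed (use Y in auto)
qed

lemma right_indep_subset: "right_indep m B \<Longrightarrow> A \<subseteq> B \<Longrightarrow> right_indep m A"
  unfolding right_indep_def by (meson order_trans)

lemma finite_right_indep:
  assumes "right_indep m B" "B \<subseteq> carrier_vec m"
  shows "finite B"
proof (rule ccontr)
  assume "infinite B"
  then obtain A where A: "A \<subseteq> B" "finite A" "card A = Suc m"
    using infinite_arbitrarily_large by blast
  obtain as where as: "distinct as" "set as = A" using finite_distinct_list[OF A(2)] by blast
  then have "cancellable (mat_of_cols m as)"
    using A assms right_indep_subset[OF assms(1) A(1)] by (intro cancellable_mat_of_cols) auto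
  moreover have "mat_of_cols m as \<in> carrier_mat m (Suc m)"
    using A as distinct_card[of as] by auto
  ultimately show False using cancellable_left_inverse by (metis not_less_eq_eq order_refl)
qed

lemma right_indep_insert:
  assumes "right_indep m B" "v \<in> carrier_vec m" "v \<notin> right_span m B" "B \<subseteq> carrier_vec m"
  shows "right_indep m (insert v B)"
  unfolding right_indep_def
proof (intro allI impI)
  fix c B' assume B': "finite B'" "B' \<subseteq> insert v B" "right_lincomb m c B' = 0\<^sub>v m"
  have "v \<notin> B' \<or> c v = 0"
  proof (rule ccontr)
    assume "\<not> (v \<notin> B' \<or> c v = 0)"
    then have v: "v \<in> B'" "c v \<noteq> 0" by auto
    have "v = right_lincomb m (\<lambda>w. - (c w * inverse (c v))) (B' - {v})"
    proof (rule eq_vecI)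
      fix p assume "p < dim_vec (right_lincomb m (\<lambda>w. - (c w * inverse (c v))) (B' - {v}))"
      then have p: "p < m" by simp
      have "(\<Sum>w\<in>B'. w $ p * c w) = 0"
        using right_lincomb_index[OF p, of c B'] B'(3) p by simp
      then have "v $ p * c v + (\<Sum>w\<in>B' - {v}. w $ p * c w) = 0"
        using B'(1) v(1) by (simp add: sum.remove)
      then have "v $ p * c v = - (\<Sum>w\<in>B' - {v}. w $ p * c w)" by (simp add: eq_neg_iff_add_eq_0)
      then have "v $ p * c v * inverse (c v) = (\<Sum>w\<in>B' - {v}. w $ p * - (c w * inverse (c v)))"
        by (simp add: sum_distrib_right sum_negf mult.assoc)
      then show "v $ p = right_lincomb m (\<lambda>w. - (c w * inverse (c v))) (B' - {v}) $ p"
        using v p by (simp add: right_lincomb_index mult.assoc)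
    qed (use assms(2) in simp)
    then have "v \<in> right_span m B" unfolding right_span_def using B' by blast
    then show False using assms(3) by simp
  qed
  then have "right_lincomb m c B' = right_lincomb m c (B' - {v})"
    unfolding right_lincomb_def using B'(1)
    by (cases "v \<in> B'") (auto simp: sum.remove intro!: eq_vecI)
  then have "right_lincomb m c (B' - {v}) = 0\<^sub>v m" using B'(3) by simp
  moreover have "finite (B' - {v})" "B' - {v} \<subseteq> B" using B' by auto
  ultimately have "\<forall>w\<in>B' - {v}. c w = 0" using assms(1) unfolding right_indep_def by blast
  then show "\<forall>w\<in>B'. c w = 0" using \<open>v \<notin> B' \<or> c v = 0\<close> by auto
qed

lemma right_span_subset_carrier: "right_span m B \<subseteq> carrier_vec m"
proof
  fix u assume "u \<in> right_span m B"
  then obtain c B' where "u = right_lincomb m c B'" unfolding right_span_def by blast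
  then show "u \<in> carrier_vec m" by (intro carrier_vecI) simp
qed

text \<open>An independent set of columns of maximal size is a basis, since a column outside its span would enlarge
it.\<close>

lemma right_basis_exists: "\<exists>B. right_basis (dim_row M) (column_space M) B"
proof -
  let ?m = "dim_row M" and ?S = "set (cols M)"
  have S: "?S \<subseteq> carrier_vec ?m" by (rule cols_dim)
  let ?P = "\<lambda>B. B \<subseteq> ?S \<and> right_indep ?m B"
  have "?P {}" by (auto simp: right_indep_def)
  moreover have "\<forall>B. ?P B \<longrightarrow> card B < Suc (card ?S)" by (simp add: card_mono le_imp_less_Suc)
  ultimately obtain B where B: "?P B" "\<And>B'. ?P B' \<Longrightarrow> card B' \<le> card B"
    using ex_has_greatest_nat[of ?P "{}" card "Suc (card ?S)"] by blast
  have finB: "finite B" using B(1) finite_subset by blast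
  obtain bs where bs: "set bs = B" using finite_list[OF finB] by blast
  have Bc: "B \<subseteq> carrier_vec ?m" using B(1) S by (blast intro: order_trans)
  let ?B = "mat_of_cols ?m bs"
  have span: "right_span ?m B = column_space ?B" using right_span_list[of bs ?m] bs Bc by simp
  have in_span: "v \<in> right_span ?m B" if "v \<in> ?S" for v
  proof (rule ccontr)
    assume nv: "v \<notin> right_span ?m B"
    have "v \<notin> B"
    proof
      assume vB: "v \<in> B"
      have "dim_vec v = ?m" using S that by (intro carrier_vecD) blast
      then have "v = right_lincomb ?m (\<lambda>_. 1) {v}"
        by (intro eq_vecI) (auto simp: right_lincomb_index)
      then show False using nv vB unfolding right_span_def by blast
    qed
    moreover have "?P (insert v B)" using right_indep_insert[of ?m B v] B(1) nv Bc subsetD[OF S that] that by auto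
    ultimately show False using B(2)[of "insert v B"] finB by simp
  qed
  have "col M j \<in> column_space ?B" if "j < dim_col M" for j
    using in_span[of "col M j"] that unfolding span by (auto simp: cols_def)
  then have "column_space M \<subseteq> column_space ?B"
    using factor_through_columns[of M ?B] column_space_subset_iff[of M ?B] by auto
  moreover have "right_span ?m B \<subseteq> right_span ?m ?S" unfolding right_span_def using B(1) by blast
  ultimately have "right_span ?m B = column_space M"
    using right_span_cols[of M] span by auto
  moreover have "B \<subseteq> column_space M" 
  proof
    fix v assume v: "v \<in> B"
    have "dim_vec v = ?m" using Bc v by (intro carrier_vecD) blast
    then have "v = right_lincomb ?m (\<lambda>_. 1) {v}"
      by (intro eq_vecI) (auto simp: right_lincomb_index)
    then have "v \<in> right_span ?m B" using v unfolding right_span_def by blast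
    then show "v \<in> column_space M" using calculation by simp
  qed
  ultimately show ?thesis using B(1) unfolding right_basis_def by blast
qed

lemma q_rank_factor:
  assumes "M \<in> carrier_mat m n"
  obtains B C Y where "B \<in> carrier_mat m (q_rank M)" "C \<in> carrier_mat (q_rank M) n"
    "Y \<in> carrier_mat n (q_rank M)" "cancellable B" "M = B * C" "B = M * Y"
proof -
  define S where "S = (SOME S. right_basis m (column_space M) S)"
  have basis: "right_basis m (column_space M) S"
    unfolding S_def using someI_ex[OF right_basis_exists[of M]] assms by auto
  have rank: "q_rank M = card S"
    unfolding q_rank_def right_span_cols right_dim_def S_def using assms by auto
  have Sc: "S \<subseteq> carrier_vec m"
    using basis right_span_subset_carrier[of m S] unfolding right_basis_def by auto
  have "finite S" using finite_right_indep[OF _ Sc] basis by (auto simp: right_basis_def)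
  then obtain bs where bs: "set bs = S" "distinct bs" using finite_distinct_list by blast
  define B where "B = mat_of_cols m bs"
  have len: "length bs = q_rank M" using bs distinct_card[of bs] rank by simp
  have B: "B \<in> carrier_mat m (q_rank M)" by (simp add: B_def len[symmetric])
  have "cancellable B" unfolding B_def
    by (rule cancellable_mat_of_cols) (use bs Sc basis in \<open>auto simp: right_basis_def\<close>)
  moreover have cs: "column_space M = column_space B"
    unfolding B_def using right_span_list[of bs m] bs Sc basis by (simp add: right_basis_def)
  moreover obtain C where "C \<in> carrier_mat (q_rank M) n" "M = B * C"
    using column_space_subset_iff[of M B] cs B assms by auto
  moreover obtain Y where "Y \<in> carrier_mat n (q_rank M)" "B = M * Y"
    using column_space_subset_iff[of B M] cs B assms by auto
  ultimately show thesis using that B by blast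
qed

lemma q_rank_cong:
  assumes "N = M * Z" "M = N * Z'" "dim_row Z = dim_col M" "dim_row Z' = dim_col N"
  shows "q_rank N = q_rank M"
proof -
  have dims: "dim_row N = dim_row M" using assms(1) by simp
  have "dim_col Z = dim_col N" using assms(1) by simp
  moreover have "dim_col Z' = dim_col M" using arg_cong[OF assms(2), of dim_col] by simp
  ultimately have "column_space N = column_space M"
    using column_space_subset_iff[of N M] column_space_subset_iff[of M N] dims assms
    by (metis carrier_matI subset_antisym)
  then show ?thesis using right_span_cols[of N] right_span_cols[of M] unfolding q_rank_def dims by simp
qed

text \<open>The columns of \<open>M Z\<close> lie in the column space of \<open>M\<close>. Bases \<open>B1\<close> and \<open>B2\<close> of the two spaces have the same
size, and \<open>B1 = B2 D\<close> with an injective square matrix \<open>D\<close>, which is therefore invertible.\<close>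

lemma q_rank_eq_imp_right_factor:
  assumes M: "M \<in> carrier_mat m n" and Z: "Z \<in> carrier_mat n p" and rank: "q_rank (M * Z) = q_rank M"
  obtains Z' where "Z' \<in> carrier_mat p n" "M = M * Z * Z'"
proof -
  define r where "r = q_rank M"
  obtain B2 C2 Y2 where 2: "B2 \<in> carrier_mat m r" "C2 \<in> carrier_mat r n" "Y2 \<in> carrier_mat n r"
    "cancellable B2" "M = B2 * C2" "B2 = M * Y2" using q_rank_factor[OF M] unfolding r_def by metis
  have MZ: "M * Z \<in> carrier_mat m p" using M Z by auto
  obtain B1 C1 Y1 where 1: "B1 \<in> carrier_mat m r" "C1 \<in> carrier_mat r p" "Y1 \<in> carrier_mat p r"
    "cancellable B1" "M * Z = B1 * C1" "B1 = M * Z * Y1"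
    using q_rank_factor[OF MZ] unfolding r_def rank by metis
  define D where "D = C2 * (Z * Y1)"
  have D: "D \<in> carrier_mat r r" unfolding D_def by (rule mult_carrier_mat[OF 2(2) mult_carrier_mat[OF Z 1(3)]])
  have BD: "B1 = B2 * D"
  proof -
    have "B1 = M * (Z * Y1)" unfolding 1(6) by (rule mat_assoc) (use 1(3) M Z in auto)
    also have "\<dots> = B2 * C2 * (Z * Y1)" using 2(5) by simp
    also have "\<dots> = B2 * D" unfolding D_def using 1(3) 2(1,2) Z by (simp add: mat_assoc)
    finally show ?thesis .
  qed
  have "cancellable D"
    unfolding cancellable_def
  proof (intro allI impI)
    fix Y :: "quat mat" assume Y: "dim_row Y = dim_col D" "D * Y = 0\<^sub>m (dim_row D) (dim_col Y)"
    have "B1 * Y = B2 * (D * Y)" unfolding BD using D 2(1) Y(1) by (simp add: mat_assoc)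
    also have "\<dots> = 0\<^sub>m m (dim_col Y)" unfolding Y(2) using D 2(1) by simp
    finally show "Y = 0\<^sub>m (dim_col D) (dim_col Y)" using cancellableD[OF 1(4), of Y] 1(1) D Y(1) by simp
  qed
  then obtain L where L: "L \<in> carrier_mat r r" "D * L = 1\<^sub>m r"
    using cancellable_left_inverse[OF D] by metis
  define Z' where "Z' = Y1 * (L * C2)"
  have "M * Z * Z' = M * Z * Y1 * (L * C2)" unfolding Z'_def using 1(3) 2(2) L(1) M Z by (simp add: mat_assoc)
  also have "\<dots> = B2 * (D * L) * C2"
    unfolding 1(6)[symmetric] unfolding BD using D L(1) 2(1,2) by (simp add: mat_assoc)
  also have "\<dots> = M" unfolding L(2) using 2(1,2,5) by simp
  finally have "M = M * Z * Z'" by simp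
  moreover have "Z' \<in> carrier_mat p n" unfolding Z'_def using 1(3) L(1) 2(2) by auto
  ultimately show thesis using that by blast
qed

text \<open>With a rank factorization \<open>M = B C\<close> the projection becomes \<open>P = B E\<close>. Since \<open>P\<close> fixes the columns of
\<open>B\<close>, the product \<open>E B\<close> is an identity matrix whose size is the rank.\<close>

lemma retrace_projection:
  assumes M: "M \<in> carrier_mat n n" and P: "P \<in> carrier_mat n n" "P = M * Q" "Q \<in> carrier_mat n n" "P * M = M"
  shows "retrace P = real (q_rank M)"
proof -
  obtain B C Y where B: "B \<in> carrier_mat n (q_rank M)" "C \<in> carrier_mat (q_rank M) n"
    "Y \<in> carrier_mat n (q_rank M)" "cancellable B" "M = B * C" "B = M * Y"
    using q_rank_factor[OF M] .
  let ?r = "q_rank M"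
  define E where "E = C * Q"
  have E: "E \<in> carrier_mat ?r n" unfolding E_def by (rule mult_carrier_mat[OF B(2) P(3)])
  have PE: "P = B * E"
  proof -
    have "P = B * C * Q" using P(2) B(5) by simp
    then show ?thesis unfolding E_def using B(1,2) P(3) by (simp add: mat_assoc)
  qed
  have "P * B = P * M * Y"  using M P(1) B(3,6) by (simp add: mat_assoc)
  then have "B * (E * B) = B" unfolding P(4) B(6)[symmetric] unfolding PE using B(1) E by (simp add: mat_assoc)
  then have "B * (E * B - 1\<^sub>m ?r) = 0\<^sub>m n ?r" using B(1) E by (simp add: mult_minus_mat minus_mat_self)
  then have "E * B - 1\<^sub>m ?r = 0\<^sub>m ?r ?r" using cancellableD[OF B(4), of "E * B - 1\<^sub>m ?r"] B(1) E by simp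
  then have "E * B = 1\<^sub>m ?r" by (rule minus_mat_eq_0) (use B(1) E in auto)
  then show ?thesis unfolding PE using retrace_mult_commute[of B E] B(1) E by simp
qed

section \<open>The weighted Drazin inverse\<close>

lemma hermitian_pow_cancel:
  assumes H: "H \<in> carrier_mat n n" "q_hermitian H" and Y: "dim_row Y = n"
    and zero: "H ^\<^sub>m Suc p * Y = 0\<^sub>m n (dim_col Y)"
  shows "H * Y = 0\<^sub>m n (dim_col Y)"
  using zero
proof (induction p)
  case 0
  then show ?case using H by simp
next
  case (Suc p)
  have "H ^\<^sub>m Suc (Suc p) * Y = H * (H * (H ^\<^sub>m p * Y))"
    unfolding pow_mat_Suc_left[OF H(1)] using H Y by (simp add: mat_assoc)
  then have "H * (H * (H ^\<^sub>m p * Y)) = 0\<^sub>m n (dim_col Y)" using Suc.prems by simp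
  then have "H * (H ^\<^sub>m p * Y) = 0\<^sub>m n (dim_col Y)"
    using hermitian_mult_cancel[OF H(2), of "H ^\<^sub>m p * Y"] H by simp
  then have "H ^\<^sub>m Suc p * Y = 0\<^sub>m n (dim_col Y)"
    unfolding pow_mat_Suc_left[OF H(1)] using H Y by (simp add: mat_assoc)
  then show ?case by (rule Suc.IH)
qed

text \<open>For a power of \<open>U\<close> the projection \<open>U\<^sup>s\<^sup>+\<^sup>1 T\<close> fixes not only \<open>U\<^sup>s\<^sup>+\<^sup>1\<close> but already \<open>U\<close>, again
because powers of a Hermitian matrix can be cancelled.\<close>

lemma hermitian_power_group_inverse:
  assumes U: "U \<in> carrier_mat n n" "q_hermitian U"
  obtains q T where "minor_sum n (U ^\<^sub>m Suc s) q \<noteq> 0"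
    "T = of_real (1 / minor_sum n (U ^\<^sub>m Suc s) q) \<cdot>\<^sub>m adjugate n (U ^\<^sub>m Suc s) q"
    "T * U = U * T" "U ^\<^sub>m Suc s * T * U = U" "retrace (U ^\<^sub>m Suc s * T) = real q"
proof -
  define M where "M = U ^\<^sub>m Suc s"
  have M: "M \<in> carrier_mat n n" "q_hermitian M"
    unfolding M_def using U by (auto simp del: pow_mat.simps intro: q_hermitian_pow)
  obtain q T where T: "minor_sum n M q \<noteq> 0" "T = of_real (1 / minor_sum n M q) \<cdot>\<^sub>m adjugate n M q"
    "M * (M * T) = M" "retrace (M * T) = real q"
    using hermitian_group_inverse[OF M] .
  have dT: "T \<in> carrier_mat n n" unfolding T(2) by auto
  have UM: "U * M = M * U" unfolding M_def using commute_pow_mat[OF U(1) U(1) refl] .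
  have TU: "T * U = U * T"
    unfolding T(2) using adjugate_commute[OF M U(1) UM, of q] U M
    by (simp add: mult_real_smult real_smult_mult del: of_real_divide)
  \<comment> \<open>cancelling all but one of the factors of \<open>M = U\<^sup>s\<^sup>+\<^sup>1\<close> on the left of \<open>M T - I\<close>\<close>
  have "M * (M * T - 1\<^sub>m n) = 0\<^sub>m n n"
    using M dT T(3) by (simp add: mult_minus_mat minus_mat_self)
  then have "U * (M * T - 1\<^sub>m n) = 0\<^sub>m n n"
    using hermitian_pow_cancel[OF U, of "M * T - 1\<^sub>m n" s] unfolding M_def[symmetric] by simp
  then have "U * (M * T) - U = 0\<^sub>m n n" using U M dT by (simp add: mult_minus_mat)
  then have UMT: "U * (M * T) = U" by (rule minus_mat_eq_0) (use U M dT in auto)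
  have MTU: "M * T * U = U"
  proof -
    have "M * T * U = M * U * T" using M dT U TU by (simp add: mat_assoc)
    also have "\<dots> = U" unfolding UM[symmetric] using UMT U M dT by (simp add: mat_assoc)
    finally show ?thesis .
  qed
  show thesis using that[of q T] T(1,2,4) TU MTU unfolding M_def by blast
qed

text \<open>Both inverses equal \<open>a N b\<close>: use \<open>a = a\<^sup>k\<^sup>+\<^sup>1 N\<^sup>k\<close> and \<open>N\<^sup>k = N\<^sup>k\<^sup>+\<^sup>1 b\<close> on one side, and
\<open>b = N\<^sup>k b\<^sup>k\<^sup>+\<^sup>1\<close> and \<open>N\<^sup>k = a N\<^sup>k\<^sup>+\<^sup>1\<close> on the other one.\<close>

lemma drazin_unique:
  fixes N a b :: "quat mat"
  assumes N: "N \<in> carrier_mat m m"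
    and a: "a \<in> carrier_mat m m" "N ^\<^sub>m Suc k * a = N ^\<^sub>m k" "a * N * a = a" "N * a = a * N"
    and b: "b \<in> carrier_mat m m" "N ^\<^sub>m Suc k * b = N ^\<^sub>m k" "b * N * b = b" "N * b = b * N"
  shows "a = b"
proof -
  have left: "a ^\<^sub>m Suc p * N ^\<^sub>m p = a" for p
  proof (induction p)
    case (Suc p)
    have "a ^\<^sub>m Suc (Suc p) * N ^\<^sub>m Suc p = a * (a ^\<^sub>m Suc p * N ^\<^sub>m p) * N"
      unfolding pow_mat_Suc_left[OF a(1), of "Suc p"] pow_mat.simps(2)[of N p]
      using N a(1) by (simp add: mat_assoc del: pow_mat.simps)
    also have "\<dots> = a * N * a" unfolding Suc using N a(1,4) by (simp add: mat_assoc)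
    finally show ?case using a(3) by simp
  qed (use N a(1) in simp)
  have right: "N ^\<^sub>m p * b ^\<^sub>m Suc p = b" for p
  proof (induction p)
    case (Suc p)
    have "N ^\<^sub>m Suc p * b ^\<^sub>m Suc (Suc p) = N * (N ^\<^sub>m p * b ^\<^sub>m Suc p) * b"
      unfolding pow_mat_Suc_left[OF N, of p] pow_mat.simps(2)[of b "Suc p"]
      using N b(1) by (simp add: mat_assoc del: pow_mat.simps)
    also have "\<dots> = b * N * b" unfolding Suc using b(4) by simp
    finally show ?case using b(3) by simp
  qed (use N b(1) in simp)
  have "a = a ^\<^sub>m Suc k * (N ^\<^sub>m Suc k * b)" unfolding b(2) by (rule left[symmetric])
  also have "\<dots> = a ^\<^sub>m Suc k * N ^\<^sub>m k * (N * b)"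
    unfolding pow_mat.simps(2)[of N k] using N a(1) b(1) by (simp add: mat_assoc del: pow_mat.simps)
  also have "\<dots> = a * (N * b)" unfolding left ..
  finally have 1: "a = a * (N * b)" .
  have "b = N ^\<^sub>m Suc k * a * b ^\<^sub>m Suc k" unfolding a(2) by (rule right[symmetric])
  also have "N ^\<^sub>m Suc k * a = a * N ^\<^sub>m Suc k" by (rule commute_pow_mat[OF N a(1) a(4)[symmetric], symmetric])
  also have "a * N ^\<^sub>m Suc k * b ^\<^sub>m Suc k = a * (N * (N ^\<^sub>m k * b ^\<^sub>m Suc k))"
    unfolding pow_mat_Suc_left[OF N, of k] using N a(1) b(1) by (simp add: mat_assoc del: pow_mat.simps)
  also have "\<dots> = a * (N * b)" unfolding right ..
  finally show ?thesis using 1 by simp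
qed

text \<open>For a solution \<open>Z\<close> the product \<open>Z W\<close> is the Drazin inverse of \<open>A W\<close>, and \<open>Z = (Z W)\<^sup>2 A\<close> recovers
\<open>Z\<close> from it.\<close>

lemma weighted_drazin_unique:
  assumes A: "A \<in> carrier_mat m n" and W: "W \<in> carrier_mat n m"
    and X: "is_weighted_drazin A W X" and Y: "is_weighted_drazin A W Y"
  shows "X = Y"
proof -
  define k where "k = max (mat_index (A * W)) (mat_index (W * A))"
  have drazin: "Z \<in> carrier_mat m n \<and> (A * W) ^\<^sub>m Suc k * (Z * W) = (A * W) ^\<^sub>m k \<and>
      Z * W * (A * W) * (Z * W) = Z * W \<and> A * W * (Z * W) = Z * W * (A * W) \<and> Z = Z * W * (Z * W) * A"
    if "is_weighted_drazin A W Z" for Z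
  proof -
    have Z: "Z \<in> carrier_mat m n" "(A * W) ^\<^sub>m Suc k * Z * W = (A * W) ^\<^sub>m k"
      "Z * W * A * W * Z = Z" "A * W * Z = Z * W * A"
      using that A unfolding is_weighted_drazin_def k_def[symmetric] by (auto simp: Let_def)
    have 1: "(A * W) ^\<^sub>m Suc k * (Z * W) = (A * W) ^\<^sub>m k"
      using Z(1) A W by (subst Z(2)[symmetric]) (simp add: mat_assoc[of _ Z W] del: pow_mat.simps)
    have "Z * W * (A * W) * (Z * W) = Z * W * A * W * Z * W" using Z(1) A W by (simp add: mat_assoc)
    then have 2: "Z * W * (A * W) * (Z * W) = Z * W" unfolding Z(3) .
    have "A * W * (Z * W) = A * W * Z * W" using Z(1) A W by (simp add: mat_assoc)
    also have "\<dots> = Z * W * (A * W)" unfolding Z(4) using Z(1) A W by (simp add: mat_assoc)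
    finally have 3: "A * W * (Z * W) = Z * W * (A * W)" .
    have "Z * W * A * W * Z = Z * W * (A * W * Z)" using Z(1) A W by (simp add: mat_assoc)
    also have "\<dots> = Z * W * (Z * W) * A" unfolding Z(4) using Z(1) A W by (simp add: mat_assoc)
    finally show ?thesis using 1 2 3 Z(1,3) by simp
  qed
  have AW: "A * W \<in> carrier_mat m m" using A W by auto
  have XW: "X * W \<in> carrier_mat m m" "Y * W \<in> carrier_mat m m" using drazin[OF X] drazin[OF Y] W by auto
  have "X * W = Y * W"
    using drazin_unique[OF AW XW(1) _ _ _ XW(2)] drazin[OF X] drazin[OF Y] by blast
  then show ?thesis using drazin[OF X] drazin[OF Y] by metis
qed

text \<open>The index is a least number, so some \<open>p\<close> at which the ranks stabilize has to be supplied before it can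
be used. Equality of ranks at the index propagates to all larger exponents by multiplying on the left.\<close>

lemma pow_mat_index:
  fixes N :: "quat mat"
  assumes N: "N \<in> carrier_mat m m" and ex: "q_rank (N ^\<^sub>m (p + 1)) = q_rank (N ^\<^sub>m p)" and k: "mat_index N \<le> k"
  obtains Z where "Z \<in> carrier_mat m m" "N ^\<^sub>m k = N ^\<^sub>m Suc k * Z"
proof -
  define i where "i = mat_index N"
  have "q_rank (N ^\<^sub>m (i + 1)) = q_rank (N ^\<^sub>m i)"
    unfolding i_def mat_index_def by (rule LeastI) (rule ex)
  then have "q_rank (N ^\<^sub>m i * N) = q_rank (N ^\<^sub>m i)" by simp
  then obtain Z where Z: "Z \<in> carrier_mat m m" "N ^\<^sub>m i = N ^\<^sub>m i * N * Z"
    using q_rank_eq_imp_right_factor[of "N ^\<^sub>m i" m m N m] N by auto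
  have k: "k = (k - i) + i" using k i_def by simp
  have "N ^\<^sub>m k = N ^\<^sub>m (k - i) * N ^\<^sub>m i" by (subst k) (rule pow_mat_add[OF N])
  also have "\<dots> = N ^\<^sub>m (k - i) * (N ^\<^sub>m i * N * Z)" using Z(2) by simp
  also have "\<dots> = N ^\<^sub>m (k - i) * N ^\<^sub>m i * N * Z" using N Z(1) by (simp add: mat_assoc)
  also have "N ^\<^sub>m (k - i) * N ^\<^sub>m i = N ^\<^sub>m k" using pow_mat_add[OF N, of "k - i" i] k by simp
  finally show thesis using that[OF Z(1)] by simp
qed

text \<open>The condition \<open>absorb\<close> says that the projection \<open>P = U\<^sup>k\<^sup>+\<^sup>2 T\<close> fixes \<open>U = W A\<close>. For \<open>N = A W\<close> one has
\<open>N\<^sup>p\<^sup>+\<^sup>1 = A U\<^sup>p W\<close>, so \<open>P U = U\<close> makes \<open>N\<^sup>2\<close> a right multiple of \<open>N\<^sup>3\<close>, and the ranks of the powers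
of \<open>N\<close> stabilize at \<open>2\<close> at the latest. As \<open>k\<close> is at least the index of \<open>N\<close>, it follows that \<open>N\<^sup>k = N\<^sup>k\<^sup>+\<^sup>2 Z\<^sup>2\<close> for some \<open>Z\<close>. This
reduces the first equation to the factor \<open>N\<^sup>k\<^sup>+\<^sup>2\<close>, where \<open>P\<close> can be absorbed.\<close>

theorem weighted_drazin_eq:
  assumes A: "A \<in> carrier_mat m n" and W: "W \<in> carrier_mat n m"
    and k: "k = max (mat_index (A * W)) (mat_index (W * A))"
    and T: "T \<in> carrier_mat n n" "T * (W * A) = W * A * T"
    and absorb: "(W * A) ^\<^sub>m (k + 2) * T * (W * A) = W * A"
    and rank: "q_rank ((W * A) ^\<^sub>m k * (W * A)) = q_rank ((W * A) ^\<^sub>m k)"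
  shows "weighted_drazin A W = A * (W * A) ^\<^sub>m k * T"
proof -
  define U where "U = W * A"
  define N where "N = A * W"
  have U: "U \<in> carrier_mat n n" unfolding U_def using A W by auto
  have N: "N \<in> carrier_mat m m" unfolding N_def using A W by auto
  note dims = A W U N T(1)
  have TU: "T * U = U * T" using T(2) unfolding U_def .
  define P where "P = U ^\<^sub>m (k + 2) * T"
  have P: "P \<in> carrier_mat n n" unfolding P_def by (rule mult_carrier_mat[OF pow_carrier_mat[OF U] T(1)])
  have PU: "P * U = U" using absorb unfolding P_def U_def .
  have Tpow: "T * U ^\<^sub>m p = U ^\<^sub>m p * T" for p using commute_pow_mat[OF U T(1) TU] .
  have Ppow: "P * U ^\<^sub>m p = U ^\<^sub>m p * P" for p
  proof -
    have "P * U = U ^\<^sub>m (k + 2) * U * T"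
      unfolding P_def using U T(1) TU by (simp add: mat_assoc del: pow_mat.simps)
    also have "\<dots> = U * P"
      unfolding P_def commute_pow_mat[OF U U refl, symmetric] using U T(1)
      by (simp add: mat_assoc del: pow_mat.simps)
    finally have "P * U = U * P" .
    then show ?thesis by (rule commute_pow_mat[OF U P])
  qed
  have UkP: "U ^\<^sub>m k * P = U ^\<^sub>m k"
  proof -
    obtain Z where Z: "Z \<in> carrier_mat n n" "U ^\<^sub>m k = U ^\<^sub>m k * U * Z"
      using q_rank_eq_imp_right_factor[of "U ^\<^sub>m k" n n U n] U rank unfolding U_def by auto
    have "U * (U ^\<^sub>m k * Z) = U ^\<^sub>m k * U * Z"
      unfolding pow_mat.simps(2)[symmetric] pow_mat_Suc_left[OF U]
      by (rule mat_assoc[symmetric]) (use U Z(1) in auto)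
    then have eq: "U ^\<^sub>m k = U * (U ^\<^sub>m k * Z)" using Z(2) by simp
    have "P * U ^\<^sub>m k = P * (U * (U ^\<^sub>m k * Z))" using eq by simp
    also have "\<dots> = P * U * (U ^\<^sub>m k * Z)" using P U Z(1) by (simp add: mat_assoc)
    also have "\<dots> = U ^\<^sub>m k" unfolding PU using eq by simp
    finally show ?thesis unfolding Ppow .
  qed
  have USP: "U ^\<^sub>m Suc p * P = U ^\<^sub>m Suc p" for p
  proof -
    have "U ^\<^sub>m Suc p * P = P * (U * U ^\<^sub>m p)"
      unfolding pow_mat_Suc_left[OF U, symmetric] by (rule Ppow[symmetric])
    also have "\<dots> = P * U * U ^\<^sub>m p"
      by (rule mat_assoc[symmetric]) (use U P in auto)
    finally show ?thesis unfolding PU pow_mat_Suc_left[OF U] .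
  qed
  have Npow: "N ^\<^sub>m Suc p = A * U ^\<^sub>m p * W" for p
  proof (induction p)
    case (Suc p)
    have "N ^\<^sub>m Suc (Suc p) = A * U ^\<^sub>m p * W * N" using Suc by simp
    also have "\<dots> = A * (U ^\<^sub>m p * U) * W" unfolding N_def U_def using A W by (simp add: mat_assoc)
    finally show ?case by simp
  qed (use dims in \<open>simp add: N_def\<close>)
  define X where "X = A * U ^\<^sub>m k * T"
  have X: "X \<in> carrier_mat m n" unfolding X_def using dims by auto
  define Q where "Q = X * W"
  have Q: "Q \<in> carrier_mat m m" unfolding Q_def using X W by auto
  have XU: "X * U = A * U ^\<^sub>m Suc k * T"
    unfolding X_def using dims TU by (simp add: mat_assoc)
  have AWX: "N * X = X * U"
  proof -
    have "N * X = A * (U * U ^\<^sub>m k) * T" unfolding N_def X_def U_def using A W T(1) by (simp add: mat_assoc)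
    then show ?thesis unfolding XU pow_mat_Suc_left[OF U] .
  qed
  have QN: "N * Q = Q * N"
  proof -
    have "N * Q = X * U * W" unfolding Q_def AWX[symmetric] using N X W by (simp add: mat_assoc)
    also have "\<dots> = Q * N" unfolding Q_def N_def U_def using A W X by (simp add: mat_assoc)
    finally show ?thesis .
  qed
  have NQ: "N * Q = A * U ^\<^sub>m Suc k * T * W"
    unfolding Q_def XU[symmetric] AWX[symmetric] using N X W by (simp add: mat_assoc)
  \<comment> \<open>because \<open>U\<^sup>k\<^sup>+\<^sup>1 T U\<^sup>k\<^sup>+\<^sup>2 = U\<^sup>k\<^sup>+\<^sup>1 P = U\<^sup>k\<^sup>+\<^sup>1\<close>\<close>
  have NQN: "N * Q * N ^\<^sub>m (k + 2) = N ^\<^sub>m (k + 2)"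
  proof -
    have "N * Q * N ^\<^sub>m (k + 2) = A * U ^\<^sub>m Suc k * T * W * (A * U ^\<^sub>m Suc k * W)"
      unfolding NQ using Npow[of "Suc k"] by simp
    also have "\<dots> = A * (U ^\<^sub>m Suc k * (T * (U * U ^\<^sub>m Suc k))) * W"
      unfolding U_def using A W T(1) by (simp add: mat_assoc del: pow_mat.simps)
    also have "U * U ^\<^sub>m Suc k = U ^\<^sub>m (k + 2)" using pow_mat_Suc_left[OF U, of "Suc k"] by simp
    also have "T * U ^\<^sub>m (k + 2) = P" unfolding P_def by (rule Tpow)
    also have "A * (U ^\<^sub>m Suc k * P) * W = N ^\<^sub>m (k + 2)" unfolding USP using Npow[of "Suc k"] by simp
    finally show ?thesis .
  qed
  \<comment> \<open>\<open>Q = A U\<^sup>k T W\<close> serves as the right factor with \<open>N\<^sup>3 Q = N\<^sup>2\<close>\<close>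
  have stable: "q_rank (N ^\<^sub>m (2 + 1)) = q_rank (N ^\<^sub>m 2)"
  proof (rule q_rank_cong)
    show "N ^\<^sub>m (2 + 1) = N ^\<^sub>m 2 * N" by (simp add: numeral_2_eq_2)
    have "U ^\<^sub>m 2 * (U * (U ^\<^sub>m k * T)) = U * P"
    proof -
      have "U ^\<^sub>m 2 * (U * (U ^\<^sub>m k * T)) = U * (U * U ^\<^sub>m Suc k) * T"
        unfolding pow_mat_Suc_left[OF U] using U T(1) by (simp add: mat_assoc numeral_2_eq_2)
      also have "U * U ^\<^sub>m Suc k = U ^\<^sub>m (k + 2)" using pow_mat_Suc_left[OF U, of "Suc k"] by simp
      finally show ?thesis unfolding P_def using U T(1) by (simp add: mat_assoc)
    qed
    also have "\<dots> = U" using USP[of 0] U by simp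
    finally have "A * (U ^\<^sub>m 2 * (U * (U ^\<^sub>m k * T))) * W = A * U ^\<^sub>m Suc 0 * W" using U by simp
    also have "\<dots> = N ^\<^sub>m 2" using Npow[of "Suc 0"] by (simp add: numeral_2_eq_2)
    also have "A * (U ^\<^sub>m 2 * (U * (U ^\<^sub>m k * T))) * W = A * U ^\<^sub>m 2 * W * Q"
      unfolding Q_def X_def unfolding U_def using A W T(1) by (simp add: mat_assoc)
    also have "A * U ^\<^sub>m 2 * W = N ^\<^sub>m (2 + 1)" using Npow[of 2] by simp
    finally show "N ^\<^sub>m 2 = N ^\<^sub>m (2 + 1) * Q" by simp
  qed (use N Q in auto)
  obtain Z where Z: "Z \<in> carrier_mat m m" "N ^\<^sub>m k = N ^\<^sub>m Suc k * Z"
    using pow_mat_index[OF N stable, of k] k unfolding N_def by auto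
  have Nk: "N ^\<^sub>m k = N ^\<^sub>m (k + 2) * (Z * Z)"
  proof -
    have "N ^\<^sub>m Suc k * Z = N * N ^\<^sub>m k * Z" unfolding pow_mat_Suc_left[OF N] ..
    also have "\<dots> = N * (N ^\<^sub>m Suc k * Z) * Z" unfolding Z(2)[symmetric] ..
    also have "\<dots> = N * N ^\<^sub>m Suc k * (Z * Z)" using N Z(1) by (simp add: mat_assoc)
    also have "N * N ^\<^sub>m Suc k = N ^\<^sub>m (k + 2)" using pow_mat_Suc_left[OF N, of "Suc k"] by simp
    finally show ?thesis unfolding Z(2)[symmetric] .
  qed
  have "is_weighted_drazin A W X"
    unfolding is_weighted_drazin_def k[symmetric] Let_def
  proof (intro conjI)
    show "X \<in> carrier_mat (dim_row A) (dim_col A)" using X A by auto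
    have "N ^\<^sub>m (k + 1) * X * W = N ^\<^sub>m k * N * Q"
      unfolding Q_def using N X W by (simp add: mat_assoc)
    also have "\<dots> = N ^\<^sub>m k * (N * Q)" using N Q by (simp add: mat_assoc)
    also have "\<dots> = N * Q * N ^\<^sub>m k"
    proof (rule commute_pow_mat[OF N, symmetric])
      show "N * Q \<in> carrier_mat m m" using N Q by auto
      have "N * Q * N = N * (Q * N)" by (rule mat_assoc) (use N Q in auto)
      then show "N * Q * N = N * (N * Q)" unfolding QN[symmetric] .
    qed
    also have "\<dots> = N * Q * (N ^\<^sub>m (k + 2) * (Z * Z))" using Nk by simp
    also have "\<dots> = N * Q * N ^\<^sub>m (k + 2) * (Z * Z)"
      by (rule mat_assoc[symmetric]) (use N Q Z(1) in auto)
    also have "\<dots> = N ^\<^sub>m k" unfolding NQN Nk[symmetric] ..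
    finally show "(A * W) ^\<^sub>m (k + 1) * X * W = (A * W) ^\<^sub>m k" unfolding N_def .
    have "X * W * A * W * X = X * U * (U * (U ^\<^sub>m k * T))"
      unfolding U_def X_def using A W T(1) by (simp add: mat_assoc)
    also have "\<dots> = A * U ^\<^sub>m k * (U * (T * (U * (U ^\<^sub>m k * T))))"
      unfolding XU using dims by (simp add: mat_assoc)
    also have "U * (T * (U * (U ^\<^sub>m k * T))) = P * T"
    proof -
      have "U * (T * (U * (U ^\<^sub>m k * T))) = U * (T * U ^\<^sub>m Suc k * T)"
        unfolding pow_mat_Suc_left[OF U] using dims by (simp add: mat_assoc)
      also have "\<dots> = U * U ^\<^sub>m Suc k * T * T" unfolding Tpow using dims by (simp add: mat_assoc)
      also have "U * U ^\<^sub>m Suc k = U ^\<^sub>m (k + 2)" using pow_mat_Suc_left[OF U, of "Suc k"] by simp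
      finally show ?thesis unfolding P_def .
    qed
    also have "A * U ^\<^sub>m k * (P * T) = A * (U ^\<^sub>m k * P) * T" using dims P by (simp add: mat_assoc)
    also have "\<dots> = X" unfolding UkP X_def ..
    finally show "X * W * A * W * X = X" .
    have "A * W * X = X * U" using AWX unfolding N_def .
    also have "\<dots> = X * W * A" unfolding U_def using X A W by (simp add: mat_assoc)
    finally show "A * W * X = X * W * A" .
  qed
  then show ?thesis
    unfolding weighted_drazin_def X_def[unfolded U_def, symmetric]
    using weighted_drazin_unique[OF A W] by (intro the_equality)
qed

lemma sum_hdet_eq_minor_sum:
  assumes "M \<in> carrier_mat n n" "q_hermitian M" "r \<ge> 1"
  shows "(\<Sum>\<alpha>\<in>index_sets r n. hdet \<alpha> M) = minor_sum n M r"
  unfolding minor_sum_def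
proof (rule sum.cong[OF refl])
  fix \<alpha> assume "\<alpha> \<in> index_sets r n"
  then have "finite \<alpha>" "\<alpha> \<subseteq> {..<n}" "\<alpha> \<noteq> {}" using index_setsD[of \<alpha> r n] assms(3) by auto
  then show "hdet \<alpha> M = qre (row_minor M \<alpha>)"
    using assms hermitian_on_q_hermitian[OF assms(2)] by (intro hdet_eq_row_minor) auto
qed

theorem theorem3p7:
  fixes A W U :: "quat mat" and m n k r :: nat
  assumes "A \<in> carrier_mat m n"
    and "W \<in> carrier_mat n m"
    and "U = W * A"
    and "q_hermitian U"
    and "k = max (mat_index (A * W)) (mat_index (W * A))"
    and "q_rank ((W * A) ^\<^sub>m (k + 1)) = r"
    and "q_rank ((W * A) ^\<^sub>m k) = r"
    and "r \<ge> 1"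
  shows "(\<Sum>\<alpha>\<in>index_sets r n. hdet \<alpha> ((W * A) ^\<^sub>m (k + 2))) \<noteq> 0 \<and>
    (\<forall>i<m. \<forall>j<n.
      weighted_drazin A W $$ (i, j) =
        (\<Sum>\<alpha>\<in>index_sets_at r n j.
           rdet \<alpha> j (replace_row ((W * A) ^\<^sub>m (k + 2)) j (row (A * (W * A) ^\<^sub>m k) i)))
        / of_real (\<Sum>\<alpha>\<in>index_sets r n. hdet \<alpha> ((W * A) ^\<^sub>m (k + 2))))"
proof -
  have U: "U \<in> carrier_mat n n" using assms(1-3) by auto
  define M where "M = U ^\<^sub>m (k + 2)"
  have M: "M \<in> carrier_mat n n" "q_hermitian M"
    unfolding M_def using U assms(4) by (auto simp del: pow_mat.simps intro: q_hermitian_pow)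
  have Suc: "Suc (k + 1) = k + 2" by simp
  obtain q T where T: "minor_sum n M q \<noteq> 0" "T = of_real (1 / minor_sum n M q) \<cdot>\<^sub>m adjugate n M q"
    "T * U = U * T" "M * T * U = U" "retrace (M * T) = real q"
    using hermitian_power_group_inverse[OF U assms(4), of "k + 1"] unfolding Suc M_def[symmetric] .
  have dT: "T \<in> carrier_mat n n" unfolding T(2) by auto
  have Uk: "U ^\<^sub>m (k + 1) \<in> carrier_mat n n" using U by auto
  \<comment> \<open>\<open>M T\<close> is the projection onto the column space of \<open>U\<^sup>k\<^sup>+\<^sup>1\<close>, so its real trace \<open>q\<close> is \<open>r\<close>\<close>
  have "retrace (M * T) = real (q_rank (U ^\<^sub>m (k + 1)))"
  proof (rule retrace_projection[OF Uk])
    have "M = U ^\<^sub>m (k + 1) * U" unfolding M_def by simp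
    then show "M * T = U ^\<^sub>m (k + 1) * (U * T)" using U dT by (simp add: mat_assoc)
    have "U ^\<^sub>m (k + 1) = U * U ^\<^sub>m k" using pow_mat_Suc_left[OF U, of k] by simp
    then have "M * T * U ^\<^sub>m (k + 1) = M * T * U * U ^\<^sub>m k"
      using M(1) U dT by (simp add: mat_assoc del: pow_mat.simps)
    then show "M * T * U ^\<^sub>m (k + 1) = U ^\<^sub>m (k + 1)"
      unfolding T(4) pow_mat_Suc_left[OF U, of k, symmetric] by simp
  qed (use M(1) U dT in auto)
  then have qr: "q = r" using T(5) assms(3,6) by simp
  define d where "d = minor_sum n M r"
  have hdet: "(\<Sum>\<alpha>\<in>index_sets r n. hdet \<alpha> M) = d"
    unfolding d_def using M assms(8) by (rule sum_hdet_eq_minor_sum)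
  have T_def: "T = of_real (1 / d) \<cdot>\<^sub>m adjugate n M r" using T(2) unfolding qr d_def .
  have X: "weighted_drazin A W = A * U ^\<^sub>m k * T"
    unfolding assms(3)
  proof (rule weighted_drazin_eq[OF assms(1,2,5) dT])
    show "T * (W * A) = W * A * T" using T(3) unfolding assms(3) .
    show "(W * A) ^\<^sub>m (k + 2) * T * (W * A) = W * A" using T(4) unfolding M_def assms(3) .
    show "q_rank ((W * A) ^\<^sub>m k * (W * A)) = q_rank ((W * A) ^\<^sub>m k)" using assms(6,7) by simp
  qed
  have B: "A * U ^\<^sub>m k \<in> carrier_mat m n" using assms(1) U by auto
  have "weighted_drazin A W $$ (i, j) =
      (\<Sum>\<alpha>\<in>index_sets_at r n j. rdet \<alpha> j (replace_row M j (row (A * U ^\<^sub>m k) i))) / of_real d"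
    if "i < m" "j < n" for i j
  proof -
    have "weighted_drazin A W = of_real (1 / d) \<cdot>\<^sub>m (A * U ^\<^sub>m k * adjugate n M r)"
      unfolding X T_def by (rule mult_real_smult) (use B in auto)
    then have "weighted_drazin A W $$ (i, j) = of_real (1 / d) * (A * U ^\<^sub>m k * adjugate n M r) $$ (i, j)"
      by (simp only:) (rule index_smult_mat(1), use that B in auto)
    also have "\<dots> = (A * U ^\<^sub>m k * adjugate n M r) $$ (i, j) / of_real d"
      by (subst of_real_central) (simp add: divide_inverse)
    finally show ?thesis unfolding sum_rdet_replace_row[OF M(1) B that] .
  qed
  then show ?thesis
    using T(1) unfolding assms(3)[symmetric] M_def[symmetric] hdet qr d_def[symmetric] by blast
qed

end
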